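(* Let $X,X_1,X_2,\dots$ be i.i.d. real random variables with $0<\sigma^2=\mathrm{var}(X)<\infty$. For $b\ge1$ let $\zeta_1(b),\zeta_2(b),\ldots$ be positive i.i.d. random variables (not almost surely constant) with $E_\zeta(\zeta_1^2)<\infty$, the sequences for different $b$ being i.i.d. copies of each other, independent of one another and of $X_1,X_2,\ldots$. Let $0<\alpha\le1$ and let $z_\alpha$ be defined by $P(Z\le z_\alpha)=\alpha$ with $Z$ standard normal. Put $m_n(b)=\sum_{i=1}^n\zeta_i(b)$, $$T^*_n(b)=\frac{\sum_{i=1}^n\big(\frac{\zeta_i(b)}{m_n(b)}-\frac1n\big)X_i}{S_n\sqrt{\sum_{i=1}^n\big(\frac{\zeta_i(b)}{m_n(b)}-\frac1n\big)^2}},\qquad C^{(B)}_{4,\alpha}=\inf\Big\{t:\frac1B\sum_{b=1}^BI(T^*_n(b)\le t)\ge\alpha\Big\}.$$ Then, as $n,B\to\infty$, $$C^{(B)}_{4,\alpha}\to z_\alpha\ \text{ in probability-}\bigotimes_{b=1}^\infty P_{X,\zeta(b)}.$$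
   Context: $S_n^2=\frac1n\sum_{i=1}^n(X_i-\bar X_n)^2$ with $\bar X_n=\frac1n\sum_{i=1}^nX_i$. $\bigotimes_{b=1}^\infty P_{X,\zeta(b)}$ denotes the joint probability of a single data sequence $X_1,X_2,\ldots$ and the independent sets of weights $\zeta(b)$, $b\ge1$; all $B$ bootstrap sub-samples are based on the same data. For $\alpha=1$, $z_\alpha=+\infty$. *)

theory Defs
  imports "HOL-Probability.Probability"
begin

text \<open>
  Samples are indexed from \<open>0\<close>, so \<open>x i\<close> and \<open>w i\<close> (\<open>i < n\<close>) stand for
  \<open>X\<^sub>1, \<dots>, X\<^sub>n\<close> and \<open>\<zeta>\<^sub>1, \<dots>, \<zeta>\<^sub>n\<close>, and \<open>w b\<close> (\<open>b < B\<close>) for the weight sequences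
  \<open>\<zeta>(1), \<dots>, \<zeta>(B)\<close>.
\<close>

definition sample_mean :: "nat \<Rightarrow> (nat \<Rightarrow> real) \<Rightarrow> real" where
  "sample_mean n x = (1 / real n) * (\<Sum>i<n. x i)"

definition sample_sd :: "nat \<Rightarrow> (nat \<Rightarrow> real) \<Rightarrow> real" where
  "sample_sd n x = sqrt ((1 / real n) * (\<Sum>i<n. (x i - sample_mean n x)\<^sup>2))"

definition total_weight :: "nat \<Rightarrow> (nat \<Rightarrow> real) \<Rightarrow> real" where
  "total_weight n w = (\<Sum>i<n. w i)"

text \<open>
  When the sample or the weights are constant the quotient is \<open>0\<close> by the convention for
  division by zero.
\<close>

definition T_star :: "nat \<Rightarrow> (nat \<Rightarrow> real) \<Rightarrow> (nat \<Rightarrow> real) \<Rightarrow> real" where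
  "T_star n x w =
     (\<Sum>i<n. (w i / total_weight n w - 1 / real n) * x i) /
     (sample_sd n x * sqrt (\<Sum>i<n. (w i / total_weight n w - 1 / real n)\<^sup>2))"

text \<open>
  For \<open>B \<ge> 1\<close> and \<open>0 < \<alpha> \<le> 1\<close> the set below is nonempty and bounded below, so the
  infimum is the genuine one.
\<close>

definition C_boot :: "real \<Rightarrow> nat \<Rightarrow> nat \<Rightarrow> (nat \<Rightarrow> real) \<Rightarrow> (nat \<Rightarrow> nat \<Rightarrow> real) \<Rightarrow> real" where
  "C_boot \<alpha> n B x w =
     Inf {t. (1 / real B) * (\<Sum>b<B. of_bool (T_star n x (w b) \<le> t)) \<ge> \<alpha>}"

text \<open>
  Convergence in probability to a constant of the extended real line. For finite \<open>c\<close> this is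
  \<open>P(\<bar>Y - c\<bar> \<ge> \<epsilon>) \<longrightarrow> 0\<close> for all \<open>\<epsilon> > 0\<close>; for \<open>c = \<infinity>\<close> it is \<open>P(Y \<le> K) \<longrightarrow> 0\<close> for all real \<open>K\<close>.
  Measurability is part of the definition because \<open>measure\<close> is \<open>0\<close> on nonmeasurable sets.
\<close>

definition tendsto_in_prob ::
    "'a measure \<Rightarrow> ('i \<Rightarrow> 'a \<Rightarrow> ereal) \<Rightarrow> ereal \<Rightarrow> 'i filter \<Rightarrow> bool" where
  "tendsto_in_prob M Y c F \<longleftrightarrow>
     (\<forall>i. Y i \<in> borel_measurable M) \<and>
     (\<forall>U. open U \<longrightarrow> c \<in> U \<longrightarrow>
        ((\<lambda>i. measure M {\<omega> \<in> space M. Y i \<omega> \<notin> U}) \<longlongrightarrow> 0) F)"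

text \<open>
  All the \<open>X i\<close> and all the \<open>\<zeta> b i\<close> are mutually independent: this encodes at once the
  independence inside each sequence, between the weight sequences for different \<open>b\<close>, and
  between the weights and the single data sequence shared by all of them.
\<close>

definition iid_data_and_weights ::
    "'a measure \<Rightarrow> (nat \<Rightarrow> 'a \<Rightarrow> real) \<Rightarrow> (nat \<Rightarrow> nat \<Rightarrow> 'a \<Rightarrow> real) \<Rightarrow> bool" where
  "iid_data_and_weights M X \<zeta> \<longleftrightarrow>
     prob_space.indep_vars M (\<lambda>_. borel)
       (\<lambda>j. case j of Inl i \<Rightarrow> X i | Inr (b, i) \<Rightarrow> \<zeta> b i) (UNIV :: (nat + nat \<times> nat) set) \<and>
     (\<forall>i. distr M borel (X i) = distr M borel (X 0)) \<and>
     (\<forall>b i. distr M borel (\<zeta> b i) = distr M borel (\<zeta> 0 0))"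

end

theory Submission
  imports Defs
begin

text \<open>
  The proof conditions on the data, which makes the problem one-dimensional. After cancelling the
  total weight, \<open>T_star n x w\<close> is the inner product of the weights with the studentized sample
  \<open>(x i - sample_mean n x) / (sqrt n * sample_sd n x)\<close>, a unit vector orthogonal to the constants,
  divided by the standard deviation of the weights (\<open>T_star_eq_studentized_sum\<close>). For a fixed
  sample this is a weighted sum of i.i.d. variables, and it is asymptotically standard normal as
  soon as no entry of the unit vector dominates (\<open>char_weighted_sum\<close>, \<open>T_star_clt_array\<close>). An
  argument by contradiction makes the limit uniform over all samples with small
  entries (\<open>T_star_clt_uniform\<close>), and data with a finite positive variance produce such
  samples with probability tending to \<open>1\<close> (\<open>prob_studentized_large\<close>).

  Given the data, the \<open>B\<close> bootstrap statistics are i.i.d. The second moment of the difference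
  between their empirical distribution function at \<open>t\<close> and the normal one is therefore at most
  \<open>1/B\<close> plus the second moment of the conditional error for a single statistic
  (\<open>expectation_two_weight_sequences\<close>, \<open>boot_cdf_tendsto\<close>). Both tend to \<open>0\<close>, the first in \<open>B\<close>
  and the second in \<open>n\<close>, so the empirical distribution function converges in probability when \<open>n\<close>
  and \<open>B\<close> tend to infinity jointly. Since the normal distribution function is strictly increasing,
  convergence passes to the quantiles.

  Only second moments are assumed. Hence the sample variances of the data and of the weights are
  controlled by a weak law of large numbers for variables with a first moment (\<open>mean_L1\<close>). It is
  stated in \<open>L\<^sup>1\<close>, which permits moving the random denominator into an error term whose effect on
  characteristic functions is bounded directly (\<open>char_perturb\<close>).
\<close>

section \<open>Sequences of independent identically distributed random variables\<close>

lemma integrable_mult_of_squares: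
  fixes f g :: "'a \<Rightarrow> real"
  assumes [measurable]: "f \<in> borel_measurable M" "g \<in> borel_measurable M"
    and f: "integrable M (\<lambda>x. (f x)\<^sup>2)" and g: "integrable M (\<lambda>x. (g x)\<^sup>2)"
  shows "integrable M (\<lambda>x. f x * g x)"
proof (rule Bochner_Integration.integrable_bound[of M "\<lambda>x. (f x)\<^sup>2 + (g x)\<^sup>2"])
  show "integrable M (\<lambda>x. (f x)\<^sup>2 + (g x)\<^sup>2)" using f g by simp
  have "\<bar>a * b\<bar> \<le> a\<^sup>2 + b\<^sup>2" for a b :: real
    using sum_squares_bound[of "\<bar>a\<bar>" "\<bar>b\<bar>"] mult_nonneg_nonneg[OF abs_ge_zero abs_ge_zero, of a b]
    unfolding abs_mult power2_abs by linarith
  then show "AE x in M. norm (f x * g x) \<le> norm ((f x)\<^sup>2 + (g x)\<^sup>2)" by simp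
qed simp

lemma integral_square_sum:
  fixes Y :: "nat \<Rightarrow> 'a \<Rightarrow> real"
  assumes "\<And>i. Y i \<in> borel_measurable M" "\<And>i. integrable M (\<lambda>x. (Y i x)\<^sup>2)"
  shows "integrable M (\<lambda>x. (\<Sum>i<n. Y i x)\<^sup>2)"
    and "(LINT x|M. (\<Sum>i<n. Y i x)\<^sup>2) = (\<Sum>i<n. \<Sum>j<n. LINT x|M. Y i x * Y j x)"
proof -
  have "integrable M (\<lambda>x. Y i x * Y j x)" for i j
    by (intro integrable_mult_of_squares assms)
  then show "integrable M (\<lambda>x. (\<Sum>i<n. Y i x)\<^sup>2)"
    and "(LINT x|M. (\<Sum>i<n. Y i x)\<^sup>2) = (\<Sum>i<n. \<Sum>j<n. LINT x|M. Y i x * Y j x)"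
    by (simp_all add: power2_eq_square sum_product)
qed

lemma (in prob_space) expectation_abs_le_sqrt:
  fixes Z :: "'a \<Rightarrow> real"
  assumes [measurable]: "random_variable borel Z" and "integrable M (\<lambda>x. (Z x)\<^sup>2)"
  shows "expectation (\<lambda>x. \<bar>Z x\<bar>) \<le> sqrt (expectation (\<lambda>x. (Z x)\<^sup>2))"
proof -
  have "integrable M (\<lambda>x. \<bar>Z x\<bar>)"
    using square_integrable_imp_integrable[OF assms] by simp
  then have "0 \<le> expectation (\<lambda>x. \<bar>Z x\<bar>\<^sup>2) - (expectation (\<lambda>x. \<bar>Z x\<bar>))\<^sup>2"
    using assms variance_positive[of "\<lambda>x. \<bar>Z x\<bar>"] by (subst variance_eq[symmetric]) simp_all
  then show ?thesis by (intro real_le_rsqrt) simp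
qed

text \<open>
  Centring at an arbitrary \<open>m\<close> instead of the sample mean. With \<open>m\<close> the true mean, the first
  term is an average of i.i.d. variables and the second one the square of a small quantity.
\<close>

lemma sample_sd_square:
  "(sample_sd n x)\<^sup>2 = (\<Sum>i<n. (x i - m)\<^sup>2) / n - ((\<Sum>i<n. x i - m) / n)\<^sup>2"
proof (cases "n = 0")
  case True
  then show ?thesis by (simp add: sample_sd_def)
next
  case False
  define a where "a = (\<Sum>i<n. x i - m) / n"
  have an: "(\<Sum>i<n. x i - m) = n * a" using False by (simp add: a_def)
  then have "(\<Sum>i<n. x i) = n * a + n * m" by (simp add: sum_subtractf)
  then have mean: "sample_mean n x = m + a"
    using False by (simp add: sample_mean_def add_divide_distrib)
  have "(\<Sum>i<n. (x i - sample_mean n x)\<^sup>2) = (\<Sum>i<n. (x i - m)\<^sup>2 - 2 * a * (x i - m) + a\<^sup>2)"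
    unfolding mean by (intro sum.cong refl) (simp add: power2_eq_square algebra_simps)
  also have "\<dots> = (\<Sum>i<n. (x i - m)\<^sup>2) - 2 * a * (n * a) + n * a\<^sup>2"
    by (simp only: sum.distrib sum_subtractf[of "\<lambda>i. (x i - m)\<^sup>2"] sum_distrib_left[symmetric] an
        sum_constant card_lessThan)
  also have "\<dots> = (\<Sum>i<n. (x i - m)\<^sup>2) - n * a\<^sup>2"
    by (simp add: power2_eq_square)
  finally have *: "(\<Sum>i<n. (x i - sample_mean n x)\<^sup>2) = (\<Sum>i<n. (x i - m)\<^sup>2) - n * a\<^sup>2" .
  have "(sample_sd n x)\<^sup>2 = 1 / n * (\<Sum>i<n. (x i - sample_mean n x)\<^sup>2)"
    unfolding sample_sd_def by (intro real_sqrt_pow2 mult_nonneg_nonneg sum_nonneg) simp_all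
  also have "\<dots> = (\<Sum>i<n. (x i - m)\<^sup>2) / n - a\<^sup>2"
    using False by (simp add: * right_diff_distrib)
  finally show ?thesis unfolding a_def .
qed

locale iid_sequence = prob_space M for M :: "'a measure" +
  fixes Y :: "nat \<Rightarrow> 'a \<Rightarrow> real"
  assumes indep: "indep_vars (\<lambda>_. borel) Y UNIV"
    and ident: "\<And>i. distr M borel (Y i) = distr M borel (Y 0)"
begin

lemma rv [measurable]: "random_variable borel (Y i)"
  using indep unfolding indep_vars_def2 by simp

lemma expectation_ident:
  assumes [measurable]: "f \<in> borel_measurable borel"
  shows "expectation (\<lambda>\<omega>. f (Y i \<omega>)) = (expectation (\<lambda>\<omega>. f (Y 0 \<omega>)) :: real)"
proof -
  have "expectation (\<lambda>\<omega>. f (Y i \<omega>)) = integral\<^sup>L (distr M borel (Y i)) f"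
    by (simp add: integral_distr)
  then show ?thesis by (simp add: integral_distr ident[of i])
qed

lemma integrable_ident:
  assumes [measurable]: "f \<in> borel_measurable borel" and "integrable M (\<lambda>\<omega>. f (Y 0 \<omega>) :: real)"
  shows "integrable M (\<lambda>\<omega>. f (Y i \<omega>))"
proof -
  have "integrable (distr M borel (Y i)) f"
    unfolding ident[of i] using assms by (simp add: integrable_distr_eq)
  then show ?thesis by (simp add: integrable_distr_eq)
qed

lemma iid_compose:
  assumes [measurable]: "f \<in> borel_measurable borel"
  shows "iid_sequence M (\<lambda>i \<omega>. f (Y i \<omega>) :: real)"
proof
  show "indep_vars (\<lambda>_. borel) (\<lambda>i \<omega>. f (Y i \<omega>)) UNIV"
    by (rule indep_vars_compose2[OF indep]) simp
  fix i
  have "distr M borel (\<lambda>\<omega>. f (Y j \<omega>)) = distr (distr M borel (Y j)) borel f" for j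
    by (simp add: distr_distr comp_def)
  then show "distr M borel (\<lambda>\<omega>. f (Y i \<omega>)) = distr M borel (\<lambda>\<omega>. f (Y 0 \<omega>))"
    using ident[of i] by simp
qed

lemma expectation_square_mean:
  assumes sq: "integrable M (\<lambda>\<omega>. (Y 0 \<omega>)\<^sup>2)" and "expectation (Y 0) = 0"
  shows "integrable M (\<lambda>\<omega>. ((\<Sum>i<n. Y i \<omega>) / n)\<^sup>2)"
    and "expectation (\<lambda>\<omega>. ((\<Sum>i<n. Y i \<omega>) / n)\<^sup>2) = expectation (\<lambda>\<omega>. (Y 0 \<omega>)\<^sup>2) / n"
proof -
  have sqi: "integrable M (\<lambda>\<omega>. (Y i \<omega>)\<^sup>2)" for i
    by (rule integrable_ident[where f = "\<lambda>x. x\<^sup>2"]) (use sq in auto)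
  have int: "integrable M (Y i)" for i
    by (rule square_integrable_imp_integrable[OF _ sqi]) simp
  have mean: "expectation (Y i) = 0" for i
    using expectation_ident[of "\<lambda>x. x" i] assms by simp
  have cov: "expectation (\<lambda>\<omega>. Y i \<omega> * Y j \<omega>) = (if i = j then expectation (\<lambda>\<omega>. (Y 0 \<omega>)\<^sup>2) else 0)" for i j
  proof (cases "i = j")
    case True
    then show ?thesis using expectation_ident[of "\<lambda>x. x\<^sup>2" i] by (simp add: power2_eq_square)
  next
    case False
    have "expectation (\<lambda>\<omega>. \<Prod>k\<in>{i, j}. Y k \<omega>) = (\<Prod>k\<in>{i, j}. expectation (Y k))"
      by (rule indep_vars_lebesgue_integral) (auto intro: int indep_vars_subset[OF indep])
    then show ?thesis using False mean by simp
  qed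
  note S = integral_square_sum[of Y M, OF rv sqi, where n = n]
  show "integrable M (\<lambda>\<omega>. ((\<Sum>i<n. Y i \<omega>) / n)\<^sup>2)"
    using S(1) by (simp add: power_divide)
  have "expectation (\<lambda>\<omega>. (\<Sum>i<n. Y i \<omega>)\<^sup>2) = n * expectation (\<lambda>\<omega>. (Y 0 \<omega>)\<^sup>2)"
    unfolding S(2) cov by (simp add: sum.delta)
  then show "expectation (\<lambda>\<omega>. ((\<Sum>i<n. Y i \<omega>) / n)\<^sup>2) = expectation (\<lambda>\<omega>. (Y 0 \<omega>)\<^sup>2) / n"
    by (simp add: power_divide power2_eq_square)
qed

text \<open>
  A bounded variable has a second moment, so the mean square deviation of the average is of order
  \<open>1/n\<close>.
\<close>

lemma mean_L1_bounded:
  assumes bd: "\<And>\<omega>. \<bar>Y 0 \<omega>\<bar> \<le> K"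
  shows "(\<lambda>n. expectation (\<lambda>\<omega>. \<bar>(\<Sum>i<n. Y i \<omega>) / n - expectation (Y 0)\<bar>)) \<longlonglongrightarrow> 0"
proof -
  define m where "m = expectation (Y 0)"
  interpret Z: iid_sequence M "\<lambda>i \<omega>. Y i \<omega> - m"
    by (rule iid_compose[of "\<lambda>x. x - m"]) simp
  have int: "integrable M (Y 0)" by (rule integrable_const_bound[of _ K]) (use bd in auto)
  have sq: "integrable M (\<lambda>\<omega>. (Y 0 \<omega> - m)\<^sup>2)"
  proof (rule integrable_const_bound[of _ "(K + \<bar>m\<bar>)\<^sup>2"])
    have "\<bar>Y 0 \<omega> - m\<bar> \<le> K + \<bar>m\<bar>" for \<omega> using bd[of \<omega>] by linarith
    then have "\<bar>Y 0 \<omega> - m\<bar>\<^sup>2 \<le> (K + \<bar>m\<bar>)\<^sup>2" for \<omega> by (intro power_mono) auto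
    then show "AE \<omega> in M. norm ((Y 0 \<omega> - m)\<^sup>2) \<le> (K + \<bar>m\<bar>)\<^sup>2" by simp
  qed simp
  have E0: "expectation (\<lambda>\<omega>. Y 0 \<omega> - m) = 0" using int by (simp add: m_def prob_space)
  have *: "(\<Sum>i<n. Y i \<omega>) / n - m = (\<Sum>i<n. Y i \<omega> - m) / n" if "n > 0" for n \<omega>
    using that by (simp add: sum_subtractf field_simps)
  have le: "expectation (\<lambda>\<omega>. \<bar>(\<Sum>i<n. Y i \<omega>) / n - m\<bar>) \<le> sqrt (expectation (\<lambda>\<omega>. (Y 0 \<omega> - m)\<^sup>2) / n)"
    if "n > 0" for n
    unfolding *[OF that]
    using expectation_abs_le_sqrt[OF _ Z.expectation_square_mean(1)[OF sq E0, of n]]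
    unfolding Z.expectation_square_mean(2)[OF sq E0] by simp
  show ?thesis
    unfolding m_def[symmetric]
  proof (rule tendsto_sandwich[OF _ _ tendsto_const])
    show "\<forall>\<^sub>F n in sequentially. expectation (\<lambda>\<omega>. \<bar>(\<Sum>i<n. Y i \<omega>) / n - m\<bar>) \<le> sqrt (expectation (\<lambda>\<omega>. (Y 0 \<omega> - m)\<^sup>2) / n)"
      by (rule eventually_sequentiallyI[of 1]) (simp add: le)
    have "(\<lambda>n. expectation (\<lambda>\<omega>. (Y 0 \<omega> - m)\<^sup>2) / real n) \<longlonglongrightarrow> 0"
      by (rule lim_const_over_n)
    from tendsto_real_sqrt[OF this]
    show "(\<lambda>n. sqrt (expectation (\<lambda>\<omega>. (Y 0 \<omega> - m)\<^sup>2) / real n)) \<longlonglongrightarrow> 0" by simp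
  qed simp
qed

text \<open>
  The weak law of large numbers in \<open>L\<^sup>1\<close> form, under a first moment only. It is applied to the
  squares of the observations, for which no second moment is available. The variables are
  truncated at a level \<open>K\<close> whose \<open>L\<^sup>1\<close> error is small; this error enters the average and the
  mean at most once each, uniformly in \<open>n\<close>.
\<close>

lemma mean_L1:
  assumes int: "integrable M (Y 0)"
  shows "(\<lambda>n. expectation (\<lambda>\<omega>. \<bar>(\<Sum>i<n. Y i \<omega>) / n - expectation (Y 0)\<bar>)) \<longlonglongrightarrow> 0"
proof (rule LIMSEQ_I)
  fix e :: real assume e: "e > 0"
  define \<tau> where "\<tau> K x = max (- real K) (min (real K) x)" for K :: nat and x :: real
  have \<tau>_meas [measurable]: "\<tau> K \<in> borel_measurable borel" for K
    unfolding \<tau>_def by measurable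
  have inti: "integrable M (Y i)" for i
    by (rule integrable_ident[where f = "\<lambda>x. x"]) (use int in auto)
  have "(\<lambda>K. expectation (\<lambda>\<omega>. \<bar>Y 0 \<omega> - \<tau> K (Y 0 \<omega>)\<bar>)) \<longlonglongrightarrow> expectation (\<lambda>\<omega>. 0)"
  proof (rule integral_dominated_convergence[where w = "\<lambda>\<omega>. \<bar>Y 0 \<omega>\<bar>"])
    show "AE \<omega> in M. (\<lambda>K. \<bar>Y 0 \<omega> - \<tau> K (Y 0 \<omega>)\<bar>) \<longlonglongrightarrow> 0"
    proof (rule AE_I2)
      fix \<omega>
      have "\<forall>\<^sub>F K in sequentially. \<bar>Y 0 \<omega>\<bar> \<le> real K"
        by (rule eventually_sequentiallyI[of "nat \<lceil>\<bar>Y 0 \<omega>\<bar>\<rceil>"]) linarith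
      then have "\<forall>\<^sub>F K in sequentially. \<bar>Y 0 \<omega> - \<tau> K (Y 0 \<omega>)\<bar> = 0"
        by eventually_elim (auto simp: \<tau>_def)
      then show "(\<lambda>K. \<bar>Y 0 \<omega> - \<tau> K (Y 0 \<omega>)\<bar>) \<longlonglongrightarrow> 0" by (rule tendsto_eventually)
    qed
  qed (use int in \<open>auto simp: \<tau>_def\<close>)
  then have "\<forall>\<^sub>F K in sequentially. expectation (\<lambda>\<omega>. \<bar>Y 0 \<omega> - \<tau> K (Y 0 \<omega>)\<bar>) < e / 3"
    using e by (intro order_tendstoD(2)[where y = "expectation (\<lambda>\<omega>. 0)"]) simp_all
  then obtain K where K: "expectation (\<lambda>\<omega>. \<bar>Y 0 \<omega> - \<tau> K (Y 0 \<omega>)\<bar>) < e / 3"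
    by (auto simp: eventually_sequentially)
  interpret T: iid_sequence M "\<lambda>i \<omega>. \<tau> K (Y i \<omega>)"
    by (rule iid_compose) simp
  have \<tau>_bd: "\<bar>\<tau> K x\<bar> \<le> K" for x by (auto simp: \<tau>_def)
  have intT: "integrable M (\<lambda>\<omega>. \<tau> K (Y i \<omega>))" for i
    by (rule integrable_const_bound[of _ K]) (use \<tau>_bd in auto)
  have d: "expectation (\<lambda>\<omega>. \<bar>Y i \<omega> - \<tau> K (Y i \<omega>)\<bar>) = expectation (\<lambda>\<omega>. \<bar>Y 0 \<omega> - \<tau> K (Y 0 \<omega>)\<bar>)" for i
    by (rule expectation_ident) measurable
  define D where "D = expectation (\<lambda>\<omega>. \<bar>Y 0 \<omega> - \<tau> K (Y 0 \<omega>)\<bar>)"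
  note d = d[folded D_def]
  define m m' where "m = expectation (Y 0)" and "m' = expectation (\<lambda>\<omega>. \<tau> K (Y 0 \<omega>))"
  have mm: "\<bar>m' - m\<bar> \<le> expectation (\<lambda>\<omega>. \<bar>Y 0 \<omega> - \<tau> K (Y 0 \<omega>)\<bar>)"
    using integral_abs_bound[of M "\<lambda>\<omega>. Y 0 \<omega> - \<tau> K (Y 0 \<omega>)"] int intT[of 0]
    by (simp add: m_def m'_def abs_minus_commute)
  have bound: "expectation (\<lambda>\<omega>. \<bar>(\<Sum>i<n. Y i \<omega>) / n - m\<bar>)
      \<le> e / 3 + expectation (\<lambda>\<omega>. \<bar>(\<Sum>i<n. \<tau> K (Y i \<omega>)) / n - m'\<bar>) + e / 3" if n: "n > 0" for n
  proof -
    have "expectation (\<lambda>\<omega>. \<bar>(\<Sum>i<n. Y i \<omega>) / n - m\<bar>)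
      \<le> expectation (\<lambda>\<omega>. (\<Sum>i<n. \<bar>Y i \<omega> - \<tau> K (Y i \<omega>)\<bar>) / n + \<bar>(\<Sum>i<n. \<tau> K (Y i \<omega>)) / n - m'\<bar> + \<bar>m' - m\<bar>)"
    proof (rule integral_mono)
      fix \<omega>
      have "\<bar>(\<Sum>i<n. Y i \<omega>) / n - (\<Sum>i<n. \<tau> K (Y i \<omega>)) / n\<bar> \<le> (\<Sum>i<n. \<bar>Y i \<omega> - \<tau> K (Y i \<omega>)\<bar>) / n"
        unfolding diff_divide_distrib[symmetric] sum_subtractf[symmetric] abs_divide
        by (simp add: divide_right_mono)
      then show "\<bar>(\<Sum>i<n. Y i \<omega>) / n - m\<bar> \<le> (\<Sum>i<n. \<bar>Y i \<omega> - \<tau> K (Y i \<omega>)\<bar>) / n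
          + \<bar>(\<Sum>i<n. \<tau> K (Y i \<omega>)) / n - m'\<bar> + \<bar>m' - m\<bar>" by linarith
    qed (use inti intT in auto)
    also have "\<dots> = expectation (\<lambda>\<omega>. \<bar>Y 0 \<omega> - \<tau> K (Y 0 \<omega>)\<bar>)
        + expectation (\<lambda>\<omega>. \<bar>(\<Sum>i<n. \<tau> K (Y i \<omega>)) / n - m'\<bar>) + \<bar>m' - m\<bar>"
      using inti intT n by (simp add: d prob_space)
    also have "\<dots> \<le> e / 3 + expectation (\<lambda>\<omega>. \<bar>(\<Sum>i<n. \<tau> K (Y i \<omega>)) / n - m'\<bar>) + e / 3"
      using K mm by linarith
    finally show ?thesis .
  qed
  have "(\<lambda>n. expectation (\<lambda>\<omega>. \<bar>(\<Sum>i<n. \<tau> K (Y i \<omega>)) / n - m'\<bar>)) \<longlonglongrightarrow> 0"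
    unfolding m'_def by (rule T.mean_L1_bounded) (rule \<tau>_bd)
  then have "\<forall>\<^sub>F n in sequentially. expectation (\<lambda>\<omega>. \<bar>(\<Sum>i<n. \<tau> K (Y i \<omega>)) / n - m'\<bar>) < e / 3"
    by (rule order_tendstoD(2)) (use e in simp)
  then obtain N where N: "\<And>n. n \<ge> N \<Longrightarrow> expectation (\<lambda>\<omega>. \<bar>(\<Sum>i<n. \<tau> K (Y i \<omega>)) / n - m'\<bar>) < e / 3"
    by (auto simp: eventually_sequentially)
  show "\<exists>N. \<forall>n\<ge>N. norm (expectation (\<lambda>\<omega>. \<bar>(\<Sum>i<n. Y i \<omega>) / n - expectation (Y 0)\<bar>) - 0) < e"
  proof (intro exI allI impI)
    fix n assume "n \<ge> max 1 N"
    then have "expectation (\<lambda>\<omega>. \<bar>(\<Sum>i<n. Y i \<omega>) / n - m\<bar>) < e"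
      using bound[of n] N[of n] by simp
    then show "norm (expectation (\<lambda>\<omega>. \<bar>(\<Sum>i<n. Y i \<omega>) / n - expectation (Y 0)\<bar>) - 0) < e"
      by (simp add: m_def abs_of_nonneg)
  qed
qed

lemma sample_variance_L1:
  assumes sq: "integrable M (\<lambda>\<omega>. (Y 0 \<omega>)\<^sup>2)"
  shows "\<And>n. integrable M (\<lambda>\<omega>. (sample_sd n (\<lambda>i. Y i \<omega>))\<^sup>2)"
    and "(\<lambda>n. expectation (\<lambda>\<omega>. \<bar>(sample_sd n (\<lambda>i. Y i \<omega>))\<^sup>2 - variance (Y 0)\<bar>)) \<longlonglongrightarrow> 0"
proof -
  define m v where "m = expectation (Y 0)" and "v = variance (Y 0)"
  have int0: "integrable M (Y 0)"
    by (rule square_integrable_imp_integrable[OF _ sq]) simp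
  interpret Z: iid_sequence M "\<lambda>i \<omega>. Y i \<omega> - m" by (rule iid_compose) simp
  interpret Q: iid_sequence M "\<lambda>i \<omega>. (Y i \<omega> - m)\<^sup>2" by (rule iid_compose) simp
  have sqZ: "integrable M (\<lambda>\<omega>. (Y 0 \<omega> - m)\<^sup>2)"
    using sq int0 by (simp add: power2_diff)
  have sqZi: "integrable M (\<lambda>\<omega>. (Y i \<omega> - m)\<^sup>2)" for i
    by (rule integrable_ident[where f = "\<lambda>x. (x - m)\<^sup>2"]) (use sqZ in auto)
  have E0: "expectation (\<lambda>\<omega>. Y 0 \<omega> - m) = 0" using int0 by (simp add: m_def prob_space)
  note Zm = Z.expectation_square_mean[OF sqZ E0]
  note id = sample_sd_square[where m = m]
  show int: "integrable M (\<lambda>\<omega>. (sample_sd n (\<lambda>i. Y i \<omega>))\<^sup>2)" for n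
    unfolding id using Zm(1)[of n] sqZi by simp
  have le: "expectation (\<lambda>\<omega>. \<bar>(sample_sd n (\<lambda>i. Y i \<omega>))\<^sup>2 - v\<bar>)
      \<le> expectation (\<lambda>\<omega>. \<bar>(\<Sum>i<n. (Y i \<omega> - m)\<^sup>2) / n - v\<bar>) + v / n" for n
  proof -
    have "expectation (\<lambda>\<omega>. \<bar>(sample_sd n (\<lambda>i. Y i \<omega>))\<^sup>2 - v\<bar>)
      \<le> expectation (\<lambda>\<omega>. \<bar>(\<Sum>i<n. (Y i \<omega> - m)\<^sup>2) / n - v\<bar> + ((\<Sum>i<n. Y i \<omega> - m) / n)\<^sup>2)"
    proof (rule integral_mono)
      fix \<omega> show "\<bar>(sample_sd n (\<lambda>i. Y i \<omega>))\<^sup>2 - v\<bar>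
        \<le> \<bar>(\<Sum>i<n. (Y i \<omega> - m)\<^sup>2) / n - v\<bar> + ((\<Sum>i<n. Y i \<omega> - m) / n)\<^sup>2"
        unfolding id using zero_le_power2[of "(\<Sum>i<n. Y i \<omega> - m) / n"] by linarith
    qed (use int Zm(1)[of n] sqZi in auto)
    also have "\<dots> = expectation (\<lambda>\<omega>. \<bar>(\<Sum>i<n. (Y i \<omega> - m)\<^sup>2) / n - v\<bar>) + v / n"
      using Zm[of n] sqZi by (simp add: v_def m_def)
    finally show ?thesis .
  qed
  show "(\<lambda>n. expectation (\<lambda>\<omega>. \<bar>(sample_sd n (\<lambda>i. Y i \<omega>))\<^sup>2 - variance (Y 0)\<bar>)) \<longlonglongrightarrow> 0"
    unfolding v_def[symmetric]
  proof (rule tendsto_sandwich[OF _ _ tendsto_const])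
    show "\<forall>\<^sub>F n in sequentially. expectation (\<lambda>\<omega>. \<bar>(sample_sd n (\<lambda>i. Y i \<omega>))\<^sup>2 - v\<bar>)
        \<le> expectation (\<lambda>\<omega>. \<bar>(\<Sum>i<n. (Y i \<omega> - m)\<^sup>2) / n - v\<bar>) + v / n"
      by (intro always_eventually allI le)
    have "(\<lambda>n. expectation (\<lambda>\<omega>. \<bar>(\<Sum>i<n. (Y i \<omega> - m)\<^sup>2) / n - v\<bar>) + v / n) \<longlonglongrightarrow> 0 + 0"
      using Q.mean_L1[OF sqZ] by (intro tendsto_add lim_const_over_n) (simp add: v_def m_def)
    then show "(\<lambda>n. expectation (\<lambda>\<omega>. \<bar>(\<Sum>i<n. (Y i \<omega> - m)\<^sup>2) / n - v\<bar>) + v / n) \<longlonglongrightarrow> 0"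
      by simp
  qed (intro always_eventually allI, simp)
qed

end

section \<open>The standard normal distribution function\<close>

lemma cdf_std_normal_continuous: "isCont (cdf std_normal_distribution) t"
proof -
  interpret real_distribution std_normal_distribution by (rule real_dist_normal_dist)
  have "{t} \<in> null_sets std_normal_distribution"
  proof (subst null_sets_density_iff)
    have "AE x in lborel. x \<in> {t} \<longrightarrow> ennreal (std_normal_density x) = 0"
      using AE_lborel_singleton[of t] by eventually_elim simp
    then show "{t} \<in> sets lborel \<and> (AE x in lborel. x \<in> {t} \<longrightarrow> ennreal (std_normal_density x) = 0)"
      by simp
  qed simp
  then show ?thesis
    by (simp add: isCont_cdf measure_def null_sets_def)
qed

lemma cdf_std_normal_strict_mono:
  assumes "a < b"
  shows "cdf std_normal_distribution a < cdf std_normal_distribution b"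
proof -
  interpret real_distribution std_normal_distribution by (rule real_dist_normal_dist)
  have "measure std_normal_distribution {a<..b} \<noteq> 0"
  proof
    assume "measure std_normal_distribution {a<..b} = 0"
    then have "{a<..b} \<in> null_sets std_normal_distribution"
      by (simp add: null_sets_def emeasure_eq_measure)
    then have "AE x in lborel. x \<in> {a<..b} \<longrightarrow> ennreal (std_normal_density x) = 0"
      by (subst (asm) null_sets_density_iff) simp_all
    then have "AE x in lborel. x \<notin> {a<..b}"
    proof eventually_elim
      fix x
      assume "x \<in> {a<..b} \<longrightarrow> ennreal (std_normal_density x) = 0"
      moreover have "0 < std_normal_density x" by (rule normal_density_pos) simp
      ultimately show "x \<notin> {a<..b}" by auto
    qed
    then have "emeasure lborel {a<..b} = 0"
      by (subst (asm) AE_iff_measurable[where N = "{a<..b}"]) auto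
    then show False using assms by simp
  qed
  then have "0 < measure std_normal_distribution {a<..b}"
    by (simp add: zero_less_measure_iff)
  then show ?thesis using cdf_diff_eq[OF assms] by simp
qed

section \<open>A central limit theorem for weighted sums\<close>

text \<open>
  The quadratic error suffices: summed over the coefficients of a unit vector it gives at most the
  square of the largest one, up to a constant.
\<close>

lemma exp_minus_approx:
  fixes a :: real
  assumes "0 \<le> a"
  shows "\<bar>(1 - a) - exp (- a)\<bar> \<le> a\<^sup>2"
proof -
  have "exp (- a) \<le> 1 / (1 + a)"
    using exp_ge_add_one_self[of a] assms by (simp add: exp_minus field_simps)
  also have "\<dots> \<le> 1 - a + a\<^sup>2"
  proof -
    have "1 \<le> (1 - a + a\<^sup>2) * (1 + a)"
      using assms by (simp add: algebra_simps power2_eq_square)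
    then show ?thesis using assms by (simp add: divide_le_eq)
  qed
  finally show ?thesis using exp_ge_add_one_self[of "- a"] by (simp add: abs_le_iff)
qed

text \<open>
  An error term that is small in \<open>L\<^sup>1\<close> does not change the limit of characteristic functions. This
  replaces Slutsky's lemma.
\<close>

lemma (in prob_space) char_perturb:
  assumes [measurable]: "random_variable borel A" and int: "integrable M D"
  shows "cmod (char (distr M borel (\<lambda>\<omega>. A \<omega> - D \<omega>)) u - char (distr M borel A) u)
    \<le> \<bar>u\<bar> * expectation (\<lambda>\<omega>. \<bar>D \<omega>\<bar>)"
proof -
  have [measurable]: "random_variable borel D" using int by simp
  have I: "integrable M (\<lambda>\<omega>. iexp (f \<omega>))" if [measurable]: "random_variable borel f" for f
    by (rule integrable_const_bound[of _ 1]) auto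
  have pt: "cmod (iexp (u * (a - d)) - iexp (u * a)) \<le> \<bar>u\<bar> * \<bar>d\<bar>" for a d
  proof -
    have "iexp (u * (a - d)) - iexp (u * a) = iexp (u * a) * (iexp (- (u * d)) - 1)"
      by (simp add: algebra_simps exp_add[symmetric])
    moreover have "cmod (iexp (- (u * d)) - 1) \<le> \<bar>u * d\<bar>"
      using iexp_approx1[of "- (u * d)" 0] by simp
    ultimately show ?thesis by (simp add: norm_mult abs_mult)
  qed
  have char_eq: "char (distr M borel f) u = expectation (\<lambda>\<omega>. iexp (u * f \<omega>))"
    if [measurable]: "random_variable borel f" for f
    unfolding char_def by (rule integral_distr) measurable
  have "char (distr M borel (\<lambda>\<omega>. A \<omega> - D \<omega>)) u - char (distr M borel A) u
      = expectation (\<lambda>\<omega>. iexp (u * (A \<omega> - D \<omega>))) - expectation (\<lambda>\<omega>. iexp (u * A \<omega>))"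
    by (simp only: char_eq assms(1) borel_measurable_diff \<open>random_variable borel D\<close>)
  also have "\<dots> = expectation (\<lambda>\<omega>. iexp (u * (A \<omega> - D \<omega>)) - iexp (u * A \<omega>))"
    by (rule Bochner_Integration.integral_diff[symmetric]; rule I; measurable)
  also have "cmod \<dots> \<le> expectation (\<lambda>\<omega>. cmod (iexp (u * (A \<omega> - D \<omega>)) - iexp (u * A \<omega>)))"
    by (rule integral_norm_bound)
  also have "\<dots> \<le> expectation (\<lambda>\<omega>. \<bar>u\<bar> * \<bar>D \<omega>\<bar>)"
  proof (rule integral_mono)
    show "integrable M (\<lambda>\<omega>. cmod (iexp (u * (A \<omega> - D \<omega>)) - iexp (u * A \<omega>)))"
      by (intro integrable_norm Bochner_Integration.integrable_diff I) measurable
  qed (use int pt in auto)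
  also have "\<dots> = \<bar>u\<bar> * expectation (\<lambda>\<omega>. \<bar>D \<omega>\<bar>)" by simp
  finally show ?thesis .
qed

context iid_sequence
begin

text \<open>
  The Lindeberg argument for a triangular array \<open>c k\<close> of unit vectors whose largest coefficient
  tends to \<open>0\<close>. By independence the characteristic function of the sum is a product of
  \<open>char \<mu> (c k i * t)\<close>, and \<open>exp (- t\<^sup>2 / 2)\<close> is the product of \<open>exp (- (c k i * t)\<^sup>2 / 2)\<close> over the same
  indices. As all factors lie in the unit disc, the products differ by at most the sum of the
  differences of the factors, and each of these is at most \<open>(c k i)\<^sup>2\<close> times a quantity that
  depends only on the bound \<open>\<delta> k\<close> and tends to \<open>0\<close>.
\<close>

lemma char_weighted_sum:
  fixes c :: "nat \<Rightarrow> nat \<Rightarrow> real" and N :: "nat \<Rightarrow> nat"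
  assumes sq: "integrable M (\<lambda>\<omega>. (Y 0 \<omega>)\<^sup>2)" and mean: "expectation (Y 0) = 0"
    and var: "expectation (\<lambda>\<omega>. (Y 0 \<omega>)\<^sup>2) = 1"
    and unit: "\<And>k. (\<Sum>i<N k. (c k i)\<^sup>2) = 1"
    and small: "\<And>k i. i < N k \<Longrightarrow> \<bar>c k i\<bar> \<le> \<delta> k" and \<delta>: "\<delta> \<longlonglongrightarrow> 0"
  shows "(\<lambda>k. char (distr M borel (\<lambda>\<omega>. \<Sum>i<N k. c k i * Y i \<omega>)) t)
    \<longlonglongrightarrow> char std_normal_distribution t"
proof -
  define \<mu> where "\<mu> = distr M borel (Y 0)"
  interpret \<mu>: real_distribution \<mu> unfolding \<mu>_def by (rule real_distribution_distr) simp
  have int: "integrable M (Y 0)"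
    by (rule square_integrable_imp_integrable[OF _ sq]) simp
  \<comment> \<open>the remainder of the second order expansion of \<open>char \<mu>\<close> at \<open>0\<close>, relative to \<open>s\<^sup>2 / 6\<close>\<close>
  define \<psi> where "\<psi> s = expectation (\<lambda>\<omega>. min (6 * (Y 0 \<omega>)\<^sup>2) (\<bar>s\<bar> * \<bar>Y 0 \<omega>\<bar> ^ 3))" for s
  have \<psi>_int: "integrable M (\<lambda>\<omega>. min (6 * (Y 0 \<omega>)\<^sup>2) (\<bar>s\<bar> * \<bar>Y 0 \<omega>\<bar> ^ 3))" for s
    by (rule Bochner_Integration.integrable_bound[of M "\<lambda>\<omega>. 6 * (Y 0 \<omega>)\<^sup>2"]) (use sq in auto)
  have \<delta>0: "0 \<le> \<delta> k" for k
  proof -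
    have "N k \<noteq> 0" using unit[of k] by (intro notI) simp
    then show ?thesis using small[of 0 k] by (metis abs_ge_zero gr0I order_trans)
  qed
  have near: "cmod (char \<mu> (a * t) - complex_of_real (exp (- ((a * t)\<^sup>2 / 2)))) \<le> a\<^sup>2 * (t\<^sup>2 / 6 * \<psi> (\<delta> k * t) + t ^ 4 * (\<delta> k)\<^sup>2)"
    if a: "\<bar>a\<bar> \<le> \<delta> k" for a k
  proof -
    have 1: "cmod (char \<mu> (a * t) - (1 - (a * t)\<^sup>2 * 1 / 2)) \<le> (a * t)\<^sup>2 / 6 * \<psi> (a * t)"
      unfolding \<psi>_def
      by (rule char_approx3'[OF rv int sq mean _ \<mu>_def]) (simp add: mean var)
    have "\<psi> (a * t) \<le> \<psi> (\<delta> k * t)"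
      unfolding \<psi>_def
    proof (rule integral_mono[OF \<psi>_int \<psi>_int])
      fix \<omega>
      have "\<bar>a * t\<bar> \<le> \<bar>\<delta> k * t\<bar>" using a by (simp add: abs_mult mult_right_mono)
      then have "\<bar>a * t\<bar> * \<bar>Y 0 \<omega>\<bar> ^ 3 \<le> \<bar>\<delta> k * t\<bar> * \<bar>Y 0 \<omega>\<bar> ^ 3" by (rule mult_right_mono) simp
      then show "min (6 * (Y 0 \<omega>)\<^sup>2) (\<bar>a * t\<bar> * \<bar>Y 0 \<omega>\<bar> ^ 3) \<le> min (6 * (Y 0 \<omega>)\<^sup>2) (\<bar>\<delta> k * t\<bar> * \<bar>Y 0 \<omega>\<bar> ^ 3)"
        by (intro min.mono) simp_all
    qed
    then have 2: "(a * t)\<^sup>2 / 6 * \<psi> (a * t) \<le> (a * t)\<^sup>2 / 6 * \<psi> (\<delta> k * t)" by (rule mult_left_mono) simp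
    have "cmod (complex_of_real (1 - (a * t)\<^sup>2 / 2) - complex_of_real (exp (- ((a * t)\<^sup>2 / 2)))) \<le> ((a * t)\<^sup>2 / 2)\<^sup>2"
      unfolding of_real_diff[symmetric] norm_of_real by (rule exp_minus_approx) simp
    also have "((a * t)\<^sup>2 / 2)\<^sup>2 \<le> a\<^sup>2 * (t ^ 4 * (\<delta> k)\<^sup>2)"
    proof -
      have "a\<^sup>2 \<le> (\<delta> k)\<^sup>2" using a by (metis abs_ge_zero power2_abs power_mono)
      then have "a\<^sup>2 * t ^ 4 * a\<^sup>2 \<le> a\<^sup>2 * t ^ 4 * (\<delta> k)\<^sup>2" by (intro mult_left_mono) simp_all
      moreover have "((a * t)\<^sup>2 / 2)\<^sup>2 = a\<^sup>2 * t ^ 4 * a\<^sup>2 / 4"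
        by (simp add: power_mult_distrib power_divide power2_eq_square power4_eq_xxxx)
      moreover have "0 \<le> a\<^sup>2 * t ^ 4 * a\<^sup>2" by simp
      ultimately show ?thesis unfolding mult.assoc by linarith
    qed
    finally have 3: "cmod (complex_of_real (1 - (a * t)\<^sup>2 / 2) - complex_of_real (exp (- ((a * t)\<^sup>2 / 2)))) \<le> a\<^sup>2 * (t ^ 4 * (\<delta> k)\<^sup>2)" .
    have "cmod (char \<mu> (a * t) - complex_of_real (exp (- ((a * t)\<^sup>2 / 2))))
      \<le> cmod (char \<mu> (a * t) - complex_of_real (1 - (a * t)\<^sup>2 / 2)) + cmod (complex_of_real (1 - (a * t)\<^sup>2 / 2) - complex_of_real (exp (- ((a * t)\<^sup>2 / 2))))"
      using norm_triangle_ineq[of "char \<mu> (a * t) - complex_of_real (1 - (a * t)\<^sup>2 / 2)"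
        "complex_of_real (1 - (a * t)\<^sup>2 / 2) - complex_of_real (exp (- ((a * t)\<^sup>2 / 2)))"] by simp
    also have "\<dots> \<le> (a * t)\<^sup>2 / 6 * \<psi> (\<delta> k * t) + a\<^sup>2 * (t ^ 4 * (\<delta> k)\<^sup>2)"
      using 1 2 3 by (intro add_mono) simp_all
    also have "\<dots> = a\<^sup>2 * (t\<^sup>2 / 6 * \<psi> (\<delta> k * t) + t ^ 4 * (\<delta> k)\<^sup>2)"
      by (simp add: power_mult_distrib distrib_left)
    finally show ?thesis .
  qed
  have prod: "char (distr M borel (\<lambda>\<omega>. \<Sum>i<N k. c k i * Y i \<omega>)) t = (\<Prod>i<N k. char \<mu> (c k i * t))" for k
  proof -
    have "char (distr M borel (\<lambda>\<omega>. \<Sum>i<N k. c k i * Y i \<omega>)) t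
      = (\<Prod>i<N k. char (distr M borel (\<lambda>\<omega>. c k i * Y i \<omega>)) t)"
      by (rule char_distr_sum, rule indep_vars_compose2[OF indep_vars_subset[OF indep]]) auto
    also have "\<dots> = (\<Prod>i<N k. char \<mu> (c k i * t))"
    proof (rule prod.cong[OF refl])
      fix i
      have "char (distr M borel (\<lambda>\<omega>. c k i * Y i \<omega>)) t = char (distr M borel (Y i)) (c k i * t)"
        by (simp add: char_def integral_distr mult_ac)
      then show "char (distr M borel (\<lambda>\<omega>. c k i * Y i \<omega>)) t = char \<mu> (c k i * t)"
        unfolding \<mu>_def ident[of i] .
    qed
    finally show ?thesis .
  qed
  have expprod: "complex_of_real (exp (- (t\<^sup>2 / 2))) = (\<Prod>i<N k. complex_of_real (exp (- ((c k i * t)\<^sup>2 / 2))))" for k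
  proof -
    have "(\<Sum>i<N k. (c k i * t)\<^sup>2) = t\<^sup>2"
      using unit[of k] by (simp add: power_mult_distrib sum_distrib_right[symmetric])
    then have "(\<Sum>i<N k. - ((c k i * t)\<^sup>2 / 2)) = - (t\<^sup>2 / 2)"
      by (simp only: sum_divide_distrib[symmetric] sum_negf)
    then show ?thesis by (simp only: exp_sum[OF finite_lessThan, symmetric] of_real_prod[symmetric])
  qed
  have "cmod (char (distr M borel (\<lambda>\<omega>. \<Sum>i<N k. c k i * Y i \<omega>)) t - complex_of_real (exp (- (t\<^sup>2 / 2))))
      \<le> t\<^sup>2 / 6 * \<psi> (\<delta> k * t) + t ^ 4 * (\<delta> k)\<^sup>2" for k
  proof -
    have "cmod (char (distr M borel (\<lambda>\<omega>. \<Sum>i<N k. c k i * Y i \<omega>)) t - complex_of_real (exp (- (t\<^sup>2 / 2))))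
      \<le> (\<Sum>i<N k. cmod (char \<mu> (c k i * t) - complex_of_real (exp (- ((c k i * t)\<^sup>2 / 2)))))"
      unfolding prod expprod[of k]
    proof (rule norm_prod_diff)
      fix i
      show "cmod (char \<mu> (c k i * t)) \<le> 1" by (rule \<mu>.cmod_char_le_1)
      show "cmod (complex_of_real (exp (- ((c k i * t)\<^sup>2 / 2)))) \<le> 1" by simp
    qed
    also have "\<dots> \<le> (\<Sum>i<N k. (c k i)\<^sup>2 * (t\<^sup>2 / 6 * \<psi> (\<delta> k * t) + t ^ 4 * (\<delta> k)\<^sup>2))"
      using near small by (intro sum_mono) simp
    also have "\<dots> = t\<^sup>2 / 6 * \<psi> (\<delta> k * t) + t ^ 4 * (\<delta> k)\<^sup>2"
      by (simp only: sum_distrib_right[symmetric] unit mult_1)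
    finally show ?thesis .
  qed
  note bound = this
  have "(\<lambda>k. \<psi> (\<delta> k * t)) \<longlonglongrightarrow> expectation (\<lambda>\<omega>. 0)"
    unfolding \<psi>_def
  proof (rule integral_dominated_convergence[where w = "\<lambda>\<omega>. 6 * (Y 0 \<omega>)\<^sup>2"])
    show "AE \<omega> in M. (\<lambda>k. min (6 * (Y 0 \<omega>)\<^sup>2) (\<bar>\<delta> k * t\<bar> * \<bar>Y 0 \<omega>\<bar> ^ 3)) \<longlonglongrightarrow> 0"
    proof (rule AE_I2)
      fix \<omega>
      have "(\<lambda>k. min (6 * (Y 0 \<omega>)\<^sup>2) (\<bar>\<delta> k * t\<bar> * \<bar>Y 0 \<omega>\<bar> ^ 3)) \<longlonglongrightarrow> min (6 * (Y 0 \<omega>)\<^sup>2) (\<bar>0 * t\<bar> * \<bar>Y 0 \<omega>\<bar> ^ 3)"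
        by (intro tendsto_intros \<delta>)
      then show "(\<lambda>k. min (6 * (Y 0 \<omega>)\<^sup>2) (\<bar>\<delta> k * t\<bar> * \<bar>Y 0 \<omega>\<bar> ^ 3)) \<longlonglongrightarrow> 0" by (simp add: min_absorb2)
    qed
  qed (use sq in auto)
  then have "(\<lambda>k. t\<^sup>2 / 6 * \<psi> (\<delta> k * t) + t ^ 4 * (\<delta> k)\<^sup>2) \<longlonglongrightarrow> t\<^sup>2 / 6 * 0 + t ^ 4 * 0\<^sup>2"
    by (intro tendsto_intros \<delta>) simp
  then have "(\<lambda>k. t\<^sup>2 / 6 * \<psi> (\<delta> k * t) + t ^ 4 * (\<delta> k)\<^sup>2) \<longlonglongrightarrow> 0" by simp
  then have "(\<lambda>k. char (distr M borel (\<lambda>\<omega>. \<Sum>i<N k. c k i * Y i \<omega>)) t - complex_of_real (exp (- (t\<^sup>2 / 2)))) \<longlonglongrightarrow> 0"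
    by (rule Lim_null_comparison[OF always_eventually, rotated]) (use bound in auto)
  then show ?thesis
    by (simp only: LIM_zero_iff char_std_normal_distribution minus_divide_left)
qed

end

section \<open>The bootstrap statistic for a fixed sample\<close>

lemma sample_sd_nonneg: "0 \<le> sample_sd n x"
  by (simp add: sample_sd_def sum_nonneg)

lemma sample_sd_0 [simp]: "sample_sd 0 x = 0"
  by (simp add: sample_sd_def)

lemma sum_sq_eq_sample_sd: "(\<Sum>i<n. (x i - sample_mean n x)\<^sup>2) = n * (sample_sd n x)\<^sup>2"
  by (simp add: sample_sd_def sum_nonneg)

lemma sum_minus_sample_mean: "(\<Sum>i<n. x i - sample_mean n x) = 0"
  by (cases "n = 0") (simp_all add: sum_subtractf sample_mean_def)

text \<open>
  For a nonconstant sample this is a unit vector orthogonal to the constants. These two properties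
  are all that the limit theorem uses of the sample, apart from the size of the largest entry.
\<close>

definition studentized :: "nat \<Rightarrow> (nat \<Rightarrow> real) \<Rightarrow> nat \<Rightarrow> real" where
  "studentized n x i = (x i - sample_mean n x) / (sqrt n * sample_sd n x)"

lemma sum_studentized: "(\<Sum>i<n. studentized n x i) = 0"
  unfolding studentized_def sum_divide_distrib[symmetric] sum_minus_sample_mean by simp

lemma sum_square_studentized:
  assumes "0 < sample_sd n x"
  shows "(\<Sum>i<n. (studentized n x i)\<^sup>2) = 1"
proof -
  have "n \<noteq> 0" using assms by (intro notI) simp
  then show ?thesis
    using assms
    by (simp add: studentized_def power_divide sum_divide_distrib[symmetric] sum_sq_eq_sample_sd power_mult_distrib)
qed

text \<open>
  The total weight cancels between numerator and denominator, and centring can be moved from the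
  weights to the sample. The identity remains true for constant \<open>x\<close> or \<open>w\<close>, where both sides are \<open>0\<close>.
\<close>

lemma T_star_eq_studentized_sum:
  assumes n: "0 < n" and w: "0 < total_weight n w"
  shows "T_star n x w = (\<Sum>i<n. studentized n x i * w i) / sample_sd n w"
proof -
  define m where "m = total_weight n w"
  have m: "0 < m" using w by (simp add: m_def)
  have mean: "sample_mean n w = m / n" by (simp add: sample_mean_def m_def total_weight_def)
  have dev: "w i / m - 1 / n = (w i - sample_mean n w) / m" for i
    using m n by (simp add: mean diff_divide_distrib)
  have "(\<Sum>i<n. (w i - sample_mean n w) * x i) = (\<Sum>i<n. w i * x i) - sample_mean n w * (\<Sum>i<n. x i)"
    by (simp add: left_diff_distrib sum_subtractf sum_distrib_left)
  also have "sample_mean n w * (\<Sum>i<n. x i) = sample_mean n x * (\<Sum>i<n. w i)"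
    by (simp add: sample_mean_def)
  also have "(\<Sum>i<n. w i * x i) - \<dots> = (\<Sum>i<n. (x i - sample_mean n x) * w i)"
    by (simp add: left_diff_distrib sum_subtractf sum_distrib_left mult.commute[of "w _" "x _"])
  finally have num: "(\<Sum>i<n. (w i / m - 1 / n) * x i) = (\<Sum>i<n. (x i - sample_mean n x) * w i) / m"
    unfolding dev times_divide_eq_left sum_divide_distrib[symmetric] by (rule arg_cong)
  have "(\<Sum>i<n. (w i / m - 1 / n)\<^sup>2) = n * (sample_sd n w)\<^sup>2 / m\<^sup>2"
    unfolding dev by (simp add: power_divide sum_divide_distrib[symmetric] sum_sq_eq_sample_sd)
  then have den: "sqrt (\<Sum>i<n. (w i / m - 1 / n)\<^sup>2) = sqrt n * sample_sd n w / m"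
    using m by (simp add: real_sqrt_divide real_sqrt_mult sample_sd_nonneg)
  have "T_star n x w = ((\<Sum>i<n. (x i - sample_mean n x) * w i) / m) / (sample_sd n x * (sqrt n * sample_sd n w / m))"
    unfolding T_star_def m_def[symmetric] num den ..
  also have "\<dots> = (\<Sum>i<n. (x i - sample_mean n x) * w i) / (sqrt n * sample_sd n x) / sample_sd n w"
    using m by (simp add: mult_ac)
  finally show ?thesis
    by (simp add: studentized_def sum_divide_distrib)
qed

text \<open>
  Multiplying by the random denominator turns the event into one about a weighted sum of
  standardized weights and an error term, proportional to \<open>sample_sd n w / s - 1\<close>, that is small in
  \<open>L\<^sup>1\<close>. The location \<open>m\<close> is arbitrary because the studentized sample sums to \<open>0\<close>.
\<close>

lemma T_star_le_iff:
  assumes n: "0 < n" and w: "0 < total_weight n w" and sd: "0 < sample_sd n w" and s: "0 < s"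
  shows "T_star n x w \<le> t \<longleftrightarrow>
    (\<Sum>i<n. studentized n x i * ((w i - m) / s)) - t * (sample_sd n w / s - 1) \<le> t"
proof -
  have "(\<Sum>i<n. studentized n x i * ((w i - m) / s))
      = ((\<Sum>i<n. studentized n x i * w i) - m * (\<Sum>i<n. studentized n x i)) / s"
    by (simp add: right_diff_distrib sum_subtractf sum_divide_distrib sum_distrib_left diff_divide_distrib mult_ac)
  then have *: "(\<Sum>i<n. studentized n x i * ((w i - m) / s)) = (\<Sum>i<n. studentized n x i * w i) / s"
    by (simp add: sum_studentized)
  have "T_star n x w \<le> t \<longleftrightarrow> (\<Sum>i<n. studentized n x i * w i) \<le> t * sample_sd n w"
    using sd by (simp add: T_star_eq_studentized_sum[OF n w] divide_le_eq)
  also have "\<dots> \<longleftrightarrow> (\<Sum>i<n. studentized n x i * w i) / s \<le> t * sample_sd n w / s"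
    using s by (simp add: divide_le_cancel)
  finally show ?thesis unfolding * by (simp add: right_diff_distrib)
qed

lemma (in prob_space) abs_prob_diff_le:
  assumes [measurable]: "A \<in> events" "A' \<in> events" "C \<in> events"
    and "AE \<omega> in M. \<omega> \<notin> C \<longrightarrow> (\<omega> \<in> A \<longleftrightarrow> \<omega> \<in> A')"
  shows "\<bar>prob A - prob A'\<bar> \<le> prob C"
proof -
  have "prob A \<le> prob (A' \<union> C)" "prob A' \<le> prob (A \<union> C)"
    by (rule finite_measure_mono_AE; use assms(4) in \<open>auto elim: eventually_mono\<close>)+
  moreover have "prob (A' \<union> C) \<le> prob A' + prob C" "prob (A \<union> C) \<le> prob A + prob C"
    by (rule measure_Un_le; simp)+
  ultimately show ?thesis by linarith
qed

context iid_sequence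
begin

lemma sample_sd_measurable [measurable]: "random_variable borel (\<lambda>\<omega>. sample_sd n (\<lambda>i. Y i \<omega>))"
  unfolding sample_sd_def sample_mean_def by measurable

lemma T_star_measurable_weights [measurable]: "random_variable borel (\<lambda>\<omega>. T_star n x (\<lambda>i. Y i \<omega>))"
  unfolding T_star_def total_weight_def by measurable

lemma prob_sample_variance_small:
  assumes sq: "integrable M (\<lambda>\<omega>. (Y 0 \<omega>)\<^sup>2)" and var: "0 < variance (Y 0)"
  shows "(\<lambda>n. prob {\<omega> \<in> space M. (sample_sd n (\<lambda>i. Y i \<omega>))\<^sup>2 \<le> variance (Y 0) / 2}) \<longlonglongrightarrow> 0"
proof -
  define v where "v = variance (Y 0)"
  have v: "0 < v" using var by (simp add: v_def)
  note L = sample_variance_L1[OF sq, folded v_def]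
  have le: "prob {\<omega> \<in> space M. (sample_sd n (\<lambda>i. Y i \<omega>))\<^sup>2 \<le> v / 2}
      \<le> expectation (\<lambda>\<omega>. \<bar>(sample_sd n (\<lambda>i. Y i \<omega>))\<^sup>2 - v\<bar>) / (v / 2)" for n
  proof -
    have "prob {\<omega> \<in> space M. (sample_sd n (\<lambda>i. Y i \<omega>))\<^sup>2 \<le> v / 2}
      \<le> prob {\<omega> \<in> space M. v / 2 \<le> \<bar>(sample_sd n (\<lambda>i. Y i \<omega>))\<^sup>2 - v\<bar>}"
      by (rule finite_measure_mono) (auto simp: abs_if)
    also have "\<dots> \<le> expectation (\<lambda>\<omega>. \<bar>(sample_sd n (\<lambda>i. Y i \<omega>))\<^sup>2 - v\<bar>) / (v / 2)"
      by (rule integral_Markov_inequality_measure[where A = "{}"]) (use L(1) v in auto)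
    finally show ?thesis .
  qed
  have "(\<lambda>n. expectation (\<lambda>\<omega>. \<bar>(sample_sd n (\<lambda>i. Y i \<omega>))\<^sup>2 - v\<bar>) / (v / 2)) \<longlonglongrightarrow> 0 / (v / 2)"
    by (rule tendsto_divide[OF L(2) tendsto_const]) (use v in simp)
  then have "(\<lambda>n. expectation (\<lambda>\<omega>. \<bar>(sample_sd n (\<lambda>i. Y i \<omega>))\<^sup>2 - v\<bar>) / (v / 2)) \<longlonglongrightarrow> 0"
    by (simp only: div_0)
  then show ?thesis
    unfolding v_def[symmetric]
    by (rule Lim_null_comparison[rotated])
       (simp only: real_norm_def abs_of_nonneg measure_nonneg le eventually_True)
qed

text \<open>
  Here the samples are deterministic and only the weights \<open>Y\<close> are random. For a standardized
  denominator \<open>Q k\<close> the event in question is, off a set of vanishing probability,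
  \<open>A k - t * (Q k - 1) \<le> t\<close> with \<open>A k\<close> a weighted sum as in the central limit theorem above. Since
  \<open>Q k \<ge> 0\<close>, the error \<open>\<bar>Q k - 1\<bar>\<close> is at most \<open>\<bar>(Q k)\<^sup>2 - 1\<bar>\<close>, the relative error of the sample
  variance of the weights, which tends to \<open>0\<close> in \<open>L\<^sup>1\<close>.
\<close>

lemma T_star_clt_array:
  fixes x :: "nat \<Rightarrow> nat \<Rightarrow> real" and N :: "nat \<Rightarrow> nat"
  assumes sq: "integrable M (\<lambda>\<omega>. (Y 0 \<omega>)\<^sup>2)" and var: "0 < variance (Y 0)"
    and pos: "\<And>i. AE \<omega> in M. 0 < Y i \<omega>"
    and N: "filterlim N at_top sequentially"
    and sd: "\<And>k. 0 < sample_sd (N k) (x k)"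
    and small: "\<And>k i. i < N k \<Longrightarrow> \<bar>studentized (N k) (x k) i\<bar> \<le> \<delta> k" and \<delta>: "\<delta> \<longlonglongrightarrow> 0"
  shows "(\<lambda>k. prob {\<omega> \<in> space M. T_star (N k) (x k) (\<lambda>i. Y i \<omega>) \<le> t}) \<longlonglongrightarrow> cdf std_normal_distribution t"
proof -
  define m v s where "m = expectation (Y 0)" and "v = variance (Y 0)" and "s = sqrt v"
  have v: "0 < v" and s: "0 < s" and s2: "s\<^sup>2 = v" using var by (simp_all add: v_def s_def)
  have int0: "integrable M (Y 0)"
    by (rule square_integrable_imp_integrable[OF _ sq]) simp
  note L = sample_variance_L1[OF sq, folded v_def]
  interpret Z: iid_sequence M "\<lambda>i \<omega>. (Y i \<omega> - m) / s" by (rule iid_compose) simp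
  have ms: "expectation (\<lambda>\<omega>. (Y 0 \<omega> - m)\<^sup>2) = v" by (simp add: v_def m_def)
  have Zsq: "integrable M (\<lambda>\<omega>. ((Y 0 \<omega> - m) / s)\<^sup>2)"
    using sq int0 by (simp add: power2_diff power_divide)
  have Zmean: "expectation (\<lambda>\<omega>. (Y 0 \<omega> - m) / s) = 0"
    using int0 by (simp add: m_def prob_space)
  have Zvar: "expectation (\<lambda>\<omega>. ((Y 0 \<omega> - m) / s)\<^sup>2) = 1"
    using ms v by (simp add: power_divide s2)
  define A where "A k \<omega> = (\<Sum>i<N k. studentized (N k) (x k) i * ((Y i \<omega> - m) / s))" for k \<omega>
  define Q where "Q k \<omega> = sample_sd (N k) (\<lambda>i. Y i \<omega>) / s" for k \<omega>
  define D where "D k \<omega> = t * (Q k \<omega> - 1)" for k \<omega>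
  have [measurable]: "random_variable borel (A k)" "random_variable borel (Q k)" "random_variable borel (D k)" for k
    unfolding A_def Q_def D_def by measurable
  have Qle: "\<bar>Q k \<omega> - 1\<bar> \<le> \<bar>(sample_sd (N k) (\<lambda>i. Y i \<omega>))\<^sup>2 - v\<bar> / v" for k \<omega>
  proof -
    have "0 \<le> Q k \<omega>" using s by (simp add: Q_def sample_sd_nonneg)
    then have "\<bar>Q k \<omega> - 1\<bar> * 1 \<le> \<bar>Q k \<omega> - 1\<bar> * \<bar>Q k \<omega> + 1\<bar>"
      by (intro mult_left_mono) auto
    also have "\<dots> = \<bar>(Q k \<omega>)\<^sup>2 - 1\<bar>"
      by (simp add: abs_mult[symmetric] power2_eq_square algebra_simps)
    also have "(Q k \<omega>)\<^sup>2 - 1 = ((sample_sd (N k) (\<lambda>i. Y i \<omega>))\<^sup>2 - v) / v"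
      using v by (simp add: Q_def power_divide s2 diff_divide_distrib)
    finally show ?thesis using v by (simp add: abs_divide)
  qed
  have Lint: "integrable M (\<lambda>\<omega>. \<bar>(sample_sd (N k) (\<lambda>i. Y i \<omega>))\<^sup>2 - v\<bar> / v)" for k
    using L(1)[of "N k"] by simp
  have Qint: "integrable M (\<lambda>\<omega>. Q k \<omega> - 1)" for k
    by (rule Bochner_Integration.integrable_bound[OF Lint[of k]]) (use Qle v in auto)
  have Dint: "integrable M (D k)" for k
    unfolding D_def using Qint by simp
  have DL1: "(\<lambda>k. expectation (\<lambda>\<omega>. \<bar>D k \<omega>\<bar>)) \<longlonglongrightarrow> 0"
  proof (rule tendsto_sandwich[OF _ _ tendsto_const])
    have "expectation (\<lambda>\<omega>. \<bar>D k \<omega>\<bar>)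
        \<le> expectation (\<lambda>\<omega>. \<bar>t\<bar> * (\<bar>(sample_sd (N k) (\<lambda>i. Y i \<omega>))\<^sup>2 - v\<bar> / v))" for k
    proof (rule integral_mono)
      show "integrable M (\<lambda>\<omega>. \<bar>D k \<omega>\<bar>)" by (rule integrable_abs[OF Dint])
      show "integrable M (\<lambda>\<omega>. \<bar>t\<bar> * (\<bar>(sample_sd (N k) (\<lambda>i. Y i \<omega>))\<^sup>2 - v\<bar> / v))"
        by (rule integrable_mult_right[OF Lint])
      show "\<bar>D k \<omega>\<bar> \<le> \<bar>t\<bar> * (\<bar>(sample_sd (N k) (\<lambda>i. Y i \<omega>))\<^sup>2 - v\<bar> / v)" for \<omega>
        unfolding D_def abs_mult by (rule mult_left_mono[OF Qle abs_ge_zero])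
    qed
    then show "\<forall>\<^sub>F k in sequentially. expectation (\<lambda>\<omega>. \<bar>D k \<omega>\<bar>)
        \<le> \<bar>t\<bar> * (expectation (\<lambda>\<omega>. \<bar>(sample_sd (N k) (\<lambda>i. Y i \<omega>))\<^sup>2 - v\<bar>) / v)"
      by (intro always_eventually allI) simp
    have "(\<lambda>k. expectation (\<lambda>\<omega>. \<bar>(sample_sd (N k) (\<lambda>i. Y i \<omega>))\<^sup>2 - v\<bar>)) \<longlonglongrightarrow> 0"
      by (rule filterlim_compose[OF L(2) N])
    then have "(\<lambda>k. \<bar>t\<bar> * (expectation (\<lambda>\<omega>. \<bar>(sample_sd (N k) (\<lambda>i. Y i \<omega>))\<^sup>2 - v\<bar>) / v)) \<longlonglongrightarrow> \<bar>t\<bar> * (0 / v)"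
      using v by (intro tendsto_intros) simp_all
    then show "(\<lambda>k. \<bar>t\<bar> * (expectation (\<lambda>\<omega>. \<bar>(sample_sd (N k) (\<lambda>i. Y i \<omega>))\<^sup>2 - v\<bar>) / v)) \<longlonglongrightarrow> 0" by simp
  qed (intro always_eventually allI, simp)
  have "weak_conv_m (\<lambda>k. distr M borel (\<lambda>\<omega>. A k \<omega> - D k \<omega>)) std_normal_distribution"
  proof (rule levy_continuity)
    show "real_distribution (distr M borel (\<lambda>\<omega>. A k \<omega> - D k \<omega>))" for k
      by (rule real_distribution_distr) measurable
    show "real_distribution std_normal_distribution" by (rule real_dist_normal_dist)
    fix u
    have A: "(\<lambda>k. char (distr M borel (A k)) u) \<longlonglongrightarrow> char std_normal_distribution u"
      unfolding A_def using sum_square_studentized[OF sd] small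
      by (intro Z.char_weighted_sum[OF Zsq Zmean Zvar _ _ \<delta>]) auto
    have "(\<lambda>k. \<bar>u\<bar> * expectation (\<lambda>\<omega>. \<bar>D k \<omega>\<bar>)) \<longlonglongrightarrow> \<bar>u\<bar> * 0"
      by (intro tendsto_intros DL1)
    then have "(\<lambda>k. \<bar>u\<bar> * expectation (\<lambda>\<omega>. \<bar>D k \<omega>\<bar>)) \<longlonglongrightarrow> 0" by simp
    moreover have "\<forall>\<^sub>F k in sequentially. norm (char (distr M borel (\<lambda>\<omega>. A k \<omega> - D k \<omega>)) u - char (distr M borel (A k)) u)
        \<le> \<bar>u\<bar> * expectation (\<lambda>\<omega>. \<bar>D k \<omega>\<bar>)"
      by (intro always_eventually allI char_perturb Dint) simp
    ultimately have "(\<lambda>k. char (distr M borel (\<lambda>\<omega>. A k \<omega> - D k \<omega>)) u - char (distr M borel (A k)) u) \<longlonglongrightarrow> 0"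
      by (rule Lim_null_comparison[rotated])
    from tendsto_add[OF this A]
    show "(\<lambda>k. char (distr M borel (\<lambda>\<omega>. A k \<omega> - D k \<omega>)) u) \<longlonglongrightarrow> char std_normal_distribution u" by simp
  qed
  then have "(\<lambda>k. cdf (distr M borel (\<lambda>\<omega>. A k \<omega> - D k \<omega>)) t) \<longlonglongrightarrow> cdf std_normal_distribution t"
    using cdf_std_normal_continuous by (simp add: weak_conv_m_def weak_conv_def)
  moreover have "cdf (distr M borel (\<lambda>\<omega>. A k \<omega> - D k \<omega>)) t = prob {\<omega> \<in> space M. A k \<omega> - D k \<omega> \<le> t}" for k
    unfolding cdf_def by (subst measure_distr) (auto intro!: arg_cong[where f = prob])
  ultimately have AD: "(\<lambda>k. prob {\<omega> \<in> space M. A k \<omega> - D k \<omega> \<le> t}) \<longlonglongrightarrow> cdf std_normal_distribution t"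
    by simp
  \<comment> \<open>constant weights have to be excluded, as then \<open>T_star\<close> is \<open>0\<close> by convention\<close>
  define bad where "bad n = {\<omega> \<in> space M. (sample_sd n (\<lambda>i. Y i \<omega>))\<^sup>2 \<le> v / 2}" for n
  have bad: "(\<lambda>k. prob (bad (N k))) \<longlonglongrightarrow> 0"
    using filterlim_compose[OF prob_sample_variance_small[OF sq var] N] unfolding bad_def v_def .
  have "\<bar>prob {\<omega> \<in> space M. T_star (N k) (x k) (\<lambda>i. Y i \<omega>) \<le> t} - prob {\<omega> \<in> space M. A k \<omega> - D k \<omega> \<le> t}\<bar> \<le> prob (bad (N k))" for k
  proof (rule abs_prob_diff_le)
    have n: "0 < N k" using sd[of k] by (intro gr0I notI) simp
    have "AE \<omega> in M. \<forall>i. 0 < Y i \<omega>" using pos by (simp add: AE_all_countable)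
    then show "AE \<omega> in M. \<omega> \<notin> bad (N k) \<longrightarrow>
      (\<omega> \<in> {\<omega> \<in> space M. T_star (N k) (x k) (\<lambda>i. Y i \<omega>) \<le> t}) = (\<omega> \<in> {\<omega> \<in> space M. A k \<omega> - D k \<omega> \<le> t})"
      using AE_space
    proof eventually_elim
      case (elim \<omega>)
      have "0 < total_weight (N k) (\<lambda>i. Y i \<omega>)"
        unfolding total_weight_def using elim n by (intro sum_pos) auto
      moreover have "0 < sample_sd (N k) (\<lambda>i. Y i \<omega>)" if "\<omega> \<notin> bad (N k)"
        using that elim v sample_sd_nonneg[of "N k" "\<lambda>i. Y i \<omega>"]
        by (cases "sample_sd (N k) (\<lambda>i. Y i \<omega>) = 0") (auto simp: bad_def)
      ultimately have "\<omega> \<notin> bad (N k) \<Longrightarrow> T_star (N k) (x k) (\<lambda>i. Y i \<omega>) \<le> t \<longleftrightarrow> A k \<omega> - D k \<omega> \<le> t"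
        unfolding A_def D_def Q_def by (intro T_star_le_iff n s)
      then show ?case by blast
    qed
  qed (auto simp: bad_def)
  then have "(\<lambda>k. prob {\<omega> \<in> space M. T_star (N k) (x k) (\<lambda>i. Y i \<omega>) \<le> t} - prob {\<omega> \<in> space M. A k \<omega> - D k \<omega> \<le> t}) \<longlonglongrightarrow> 0"
    by (intro Lim_null_comparison[OF always_eventually bad]) simp
  from tendsto_add[OF this AD] show ?thesis by simp
qed

text \<open>
  Otherwise, a sequence of samples violating the bound for \<open>\<delta> = 1 / (k + 1)\<close> and some \<open>n \<ge> k\<close> would
  contradict the limit theorem for arrays. Uniformity in the sample is what makes it possible to
  insert random data.
\<close>

lemma T_star_clt_uniform:
  assumes sq: "integrable M (\<lambda>\<omega>. (Y 0 \<omega>)\<^sup>2)" and var: "0 < variance (Y 0)"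
    and pos: "\<And>i. AE \<omega> in M. 0 < Y i \<omega>" and \<epsilon>: "0 < \<epsilon>"
  shows "\<exists>\<delta>>0. \<exists>n0. \<forall>n\<ge>n0. \<forall>x. 0 < sample_sd n x \<longrightarrow> (\<forall>i<n. \<bar>studentized n x i\<bar> \<le> \<delta>) \<longrightarrow>
    \<bar>prob {\<omega> \<in> space M. T_star n x (\<lambda>i. Y i \<omega>) \<le> t} - cdf std_normal_distribution t\<bar> < \<epsilon>"
proof (rule ccontr)
  define far where "far n x \<longleftrightarrow> \<epsilon> \<le> \<bar>prob {\<omega> \<in> space M. T_star n x (\<lambda>i. Y i \<omega>) \<le> t} - cdf std_normal_distribution t\<bar>" for n x
  assume "\<not> ?thesis"
  then have contra: "\<exists>n\<ge>n0. \<exists>x. 0 < sample_sd n x \<and> (\<forall>i<n. \<bar>studentized n x i\<bar> \<le> \<delta>) \<and> far n x"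
    if "0 < \<delta>" for \<delta> n0
    using that unfolding far_def not_less[symmetric] by blast
  have "\<exists>n x. k \<le> n \<and> 0 < sample_sd n x \<and> (\<forall>i<n. \<bar>studentized n x i\<bar> \<le> 1 / real (Suc k)) \<and> far n x" for k
    using contra[of "1 / real (Suc k)" k] by auto
  then obtain N x where *: "\<And>k. k \<le> N k" "\<And>k. 0 < sample_sd (N k) (x k)"
    "\<And>k i. i < N k \<Longrightarrow> \<bar>studentized (N k) (x k) i\<bar> \<le> 1 / real (Suc k)"
    "\<And>k. far (N k) (x k)"
    by metis
  have "filterlim N at_top sequentially"
    by (rule filterlim_at_top_mono[OF filterlim_ident]) (use *(1) in auto)
  moreover have "(\<lambda>k. 1 / real (Suc k)) \<longlonglongrightarrow> 0"
    using LIMSEQ_inverse_real_of_nat by (simp add: inverse_eq_divide)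
  ultimately have "(\<lambda>k. prob {\<omega> \<in> space M. T_star (N k) (x k) (\<lambda>i. Y i \<omega>) \<le> t}) \<longlonglongrightarrow> cdf std_normal_distribution t"
    using *(2,3) by (intro T_star_clt_array[OF sq var pos]) auto
  from LIMSEQ_D[OF this \<epsilon>] *(4) show False
    unfolding far_def real_norm_def by (meson not_less order_refl)
qed

end

section \<open>Regularity of the data\<close>

context iid_sequence
begin

text \<open>
  A union bound and Markov's inequality for \<open>(Y 0)\<^sup>2\<close> restricted to the event
  \<open>\<eta> * sqrt n < \<bar>Y 0\<bar>\<close>: the \<open>n\<close> summands compensate the factor \<open>1/n\<close> from Markov's inequality, and
  the restricted second moment tends to \<open>0\<close> by dominated convergence.
\<close>

lemma prob_some_large:
  assumes sq: "integrable M (\<lambda>\<omega>. (Y 0 \<omega>)\<^sup>2)" and \<eta>: "0 < \<eta>"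
  shows "(\<lambda>n. prob {\<omega> \<in> space M. \<exists>i<n. \<eta> * sqrt n < \<bar>Y i \<omega>\<bar>}) \<longlonglongrightarrow> 0"
proof -
  define r where "r n y = (of_bool (\<eta> * sqrt (real n) < \<bar>y\<bar>) :: real)" for n :: nat and y :: real
  have [measurable]: "r n \<in> borel_measurable borel" for n unfolding r_def by measurable
  have rint: "integrable M (\<lambda>\<omega>. (Y 0 \<omega>)\<^sup>2 * r n (Y 0 \<omega>))" for n
    by (rule Bochner_Integration.integrable_bound[OF sq], measurable) (simp add: r_def)
  have le: "prob {\<omega> \<in> space M. \<exists>i<n. \<eta> * sqrt n < \<bar>Y i \<omega>\<bar>} \<le> expectation (\<lambda>\<omega>. (Y 0 \<omega>)\<^sup>2 * r n (Y 0 \<omega>)) / \<eta>\<^sup>2" for n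
  proof (cases "n = 0")
    case True
    have "0 \<le> expectation (\<lambda>\<omega>. (Y 0 \<omega>)\<^sup>2 * r n (Y 0 \<omega>)) / \<eta>\<^sup>2"
      by (intro divide_nonneg_nonneg integral_nonneg_AE AE_I2) (auto simp: r_def)
    then show ?thesis using True by simp
  next
    case False
    have single: "prob {\<omega> \<in> space M. \<eta> * sqrt n < \<bar>Y i \<omega>\<bar>} \<le> expectation (\<lambda>\<omega>. (Y 0 \<omega>)\<^sup>2 * r n (Y 0 \<omega>)) / (n * \<eta>\<^sup>2)" for i
    proof -
      have "prob {\<omega> \<in> space M. \<eta> * sqrt n < \<bar>Y i \<omega>\<bar>} = expectation (indicator {\<omega> \<in> space M. \<eta> * sqrt n < \<bar>Y i \<omega>\<bar>})"
        by simp
      also have "\<dots> = expectation (\<lambda>\<omega>. r n (Y i \<omega>))"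
        by (rule Bochner_Integration.integral_cong) (auto simp: r_def indicator_def)
      also have "\<dots> = expectation (\<lambda>\<omega>. r n (Y 0 \<omega>))"
        by (rule expectation_ident) simp
      also have "\<dots> \<le> expectation (\<lambda>\<omega>. (Y 0 \<omega>)\<^sup>2 * r n (Y 0 \<omega>) / (n * \<eta>\<^sup>2))"
      proof (rule integral_mono)
        show "integrable M (\<lambda>\<omega>. r n (Y 0 \<omega>))"
          by (rule integrable_const_bound[of _ 1], simp add: r_def) measurable
        show "integrable M (\<lambda>\<omega>. (Y 0 \<omega>)\<^sup>2 * r n (Y 0 \<omega>) / (n * \<eta>\<^sup>2))"
          using rint by (rule integrable_divide)
        fix \<omega>
        show "r n (Y 0 \<omega>) \<le> (Y 0 \<omega>)\<^sup>2 * r n (Y 0 \<omega>) / (n * \<eta>\<^sup>2)"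
        proof (cases "\<eta> * sqrt n < \<bar>Y 0 \<omega>\<bar>")
          case True
          then have "(\<eta> * sqrt n)\<^sup>2 \<le> (Y 0 \<omega>)\<^sup>2"
            using \<eta> by (metis abs_ge_zero less_eq_real_def mult_nonneg_nonneg of_nat_0_le_iff power2_abs power_mono real_sqrt_ge_zero)
          then show ?thesis using True False \<eta>
            by (simp add: r_def power_mult_distrib le_divide_eq mult.commute)
        qed (simp add: r_def)
      qed
      finally show ?thesis by simp
    qed
    have "{\<omega> \<in> space M. \<exists>i<n. \<eta> * sqrt n < \<bar>Y i \<omega>\<bar>} = (\<Union>i<n. {\<omega> \<in> space M. \<eta> * sqrt n < \<bar>Y i \<omega>\<bar>})"
      by auto
    also have "prob \<dots> \<le> (\<Sum>i<n. prob {\<omega> \<in> space M. \<eta> * sqrt n < \<bar>Y i \<omega>\<bar>})"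
      by (rule finite_measure_subadditive_finite) auto
    also have "\<dots> \<le> (\<Sum>i<n. expectation (\<lambda>\<omega>. (Y 0 \<omega>)\<^sup>2 * r n (Y 0 \<omega>)) / (n * \<eta>\<^sup>2))"
      by (rule sum_mono) (rule single)
    also have "\<dots> = expectation (\<lambda>\<omega>. (Y 0 \<omega>)\<^sup>2 * r n (Y 0 \<omega>)) / \<eta>\<^sup>2"
      using False by simp
    finally show ?thesis .
  qed
  have "(\<lambda>n. expectation (\<lambda>\<omega>. (Y 0 \<omega>)\<^sup>2 * r n (Y 0 \<omega>))) \<longlonglongrightarrow> expectation (\<lambda>\<omega>. 0)"
  proof (rule integral_dominated_convergence[OF _ _ sq])
    show "AE \<omega> in M. (\<lambda>n. (Y 0 \<omega>)\<^sup>2 * r n (Y 0 \<omega>)) \<longlonglongrightarrow> 0"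
    proof (rule AE_I2)
      fix \<omega>
      have "filterlim (\<lambda>n. \<eta> * sqrt (real n)) at_top sequentially"
        using \<eta> by (intro filterlim_tendsto_pos_mult_at_top[OF tendsto_const]
            filterlim_compose[OF sqrt_at_top filterlim_real_sequentially])
      then have "\<forall>\<^sub>F n in sequentially. \<bar>Y 0 \<omega>\<bar> \<le> \<eta> * sqrt (real n)"
        by (simp add: filterlim_at_top)
      then have "\<forall>\<^sub>F n in sequentially. (Y 0 \<omega>)\<^sup>2 * r n (Y 0 \<omega>) = 0"
        by eventually_elim (simp add: r_def)
      then show "(\<lambda>n. (Y 0 \<omega>)\<^sup>2 * r n (Y 0 \<omega>)) \<longlonglongrightarrow> 0" by (rule tendsto_eventually)
    qed
  qed (auto simp: r_def)
  then have "(\<lambda>n. expectation (\<lambda>\<omega>. (Y 0 \<omega>)\<^sup>2 * r n (Y 0 \<omega>)) / \<eta>\<^sup>2) \<longlonglongrightarrow> expectation (\<lambda>\<omega>. 0) / \<eta>\<^sup>2"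
    using \<eta> by (intro tendsto_divide tendsto_const) simp_all
  then have "(\<lambda>n. expectation (\<lambda>\<omega>. (Y 0 \<omega>)\<^sup>2 * r n (Y 0 \<omega>)) / \<eta>\<^sup>2) \<longlonglongrightarrow> 0"
    by simp
  then show ?thesis
    by (rule Lim_null_comparison[rotated])
       (simp only: real_norm_def abs_of_nonneg measure_nonneg le eventually_True)
qed

text \<open>
  Random data satisfy the hypotheses of the uniform limit theorem with probability tending to \<open>1\<close>:
  the numerators of the studentized sample are \<open>o(sqrt n)\<close> and the sample variance stays away
  from \<open>0\<close>, both in probability.
\<close>

lemma prob_studentized_large:
  assumes sq: "integrable M (\<lambda>\<omega>. (Y 0 \<omega>)\<^sup>2)" and var: "0 < variance (Y 0)" and \<delta>: "0 < \<delta>"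
  shows "(\<lambda>n. prob {\<omega> \<in> space M. sample_sd n (\<lambda>i. Y i \<omega>) \<le> 0 \<or> (\<exists>i<n. \<delta> < \<bar>studentized n (\<lambda>i. Y i \<omega>) i\<bar>)}) \<longlonglongrightarrow> 0"
    (is "(\<lambda>n. prob (?bad n)) \<longlonglongrightarrow> 0")
proof -
  \<comment> \<open>if all deviations from \<open>m\<close> are at most \<open>\<eta> * sqrt n\<close>, then those from the sample mean are at most
    twice this, and \<open>\<eta>\<close> is chosen to give \<open>\<delta>\<close> when the sample variance exceeds \<open>v / 2\<close>\<close>
  define m v \<eta> where "m = expectation (Y 0)" and "v = variance (Y 0)" and "\<eta> = \<delta> * sqrt (v / 2) / 2"
  have v: "0 < v" and \<eta>: "0 < \<eta>" using var \<delta> by (simp_all add: v_def \<eta>_def)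
  interpret Z: iid_sequence M "\<lambda>i \<omega>. Y i \<omega> - m" by (rule iid_compose) simp
  have int0: "integrable M (Y 0)"
    by (rule square_integrable_imp_integrable[OF _ sq]) simp
  have sqZ: "integrable M (\<lambda>\<omega>. (Y 0 \<omega> - m)\<^sup>2)"
    using sq int0 by (simp add: power2_diff)
  let ?A = "\<lambda>n. {\<omega> \<in> space M. (sample_sd n (\<lambda>i. Y i \<omega>))\<^sup>2 \<le> v / 2}"
  let ?B = "\<lambda>n :: nat. {\<omega> \<in> space M. \<exists>i<n. \<eta> * sqrt n < \<bar>Y i \<omega> - m\<bar>}"
  have sub: "?bad n \<subseteq> ?A n \<union> ?B n" for n
  proof
    fix \<omega> assume bad: "\<omega> \<in> ?bad n"
    let ?S = "sample_sd n (\<lambda>i. Y i \<omega>)"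
    show "\<omega> \<in> ?A n \<union> ?B n"
    proof (rule ccontr)
      assume "\<omega> \<notin> ?A n \<union> ?B n"
      with bad have S: "v / 2 < ?S\<^sup>2" and "\<not> (\<exists>i<n. \<eta> * sqrt n < \<bar>Y i \<omega> - m\<bar>)"
        by auto
      then have dev: "\<And>i. i < n \<Longrightarrow> \<bar>Y i \<omega> - m\<bar> \<le> \<eta> * sqrt n"
        by (meson not_le)
      have "sqrt (v / 2) < sqrt (?S\<^sup>2)" using S by (rule real_sqrt_less_mono)
      then have S': "sqrt (v / 2) < ?S" by (simp add: sample_sd_nonneg)
      moreover have "0 < sqrt (v / 2)" using v by simp
      ultimately have Spos: "0 < ?S" by linarith
      with bad obtain i where i: "i < n" "\<delta> < \<bar>studentized n (\<lambda>i. Y i \<omega>) i\<bar>" by auto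
      then have n: "0 < n" by simp
      have "sample_mean n (\<lambda>i. Y i \<omega>) - m = (\<Sum>i<n. Y i \<omega> - m) / n"
        using n by (simp add: sample_mean_def sum_subtractf diff_divide_distrib)
      also have "\<bar>\<dots>\<bar> \<le> (\<Sum>i<n. \<eta> * sqrt n) / n"
        unfolding abs_divide abs_of_nat
        by (intro divide_right_mono order_trans[OF sum_abs] sum_mono) (use dev in auto)
      finally have mean: "\<bar>sample_mean n (\<lambda>i. Y i \<omega>) - m\<bar> \<le> \<eta> * sqrt n" using n by simp
      have "\<bar>Y i \<omega> - sample_mean n (\<lambda>i. Y i \<omega>)\<bar> \<le> 2 * \<eta> * sqrt n"
        using mean dev[OF i(1)] by linarith
      also have "2 * \<eta> * sqrt n = \<delta> * (sqrt n * sqrt (v / 2))" by (simp add: \<eta>_def)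
      also have "\<dots> \<le> \<delta> * (sqrt n * ?S)" using S' \<delta> by (intro mult_left_mono) simp_all
      finally have "\<bar>studentized n (\<lambda>i. Y i \<omega>) i\<bar> \<le> \<delta>"
        using Spos n by (simp add: studentized_def abs_mult divide_le_eq)
      then show False using i(2) by simp
    qed
  qed
  have le: "prob (?bad n) \<le> prob (?A n) + prob (?B n)" for n
  proof -
    have "prob (?bad n) \<le> prob (?A n \<union> ?B n)"
      by (rule finite_measure_mono[OF sub]) measurable
    also have "\<dots> \<le> prob (?A n) + prob (?B n)"
      by (rule measure_Un_le; measurable)
    finally show ?thesis .
  qed
  have "(\<lambda>n. prob (?A n) + prob (?B n)) \<longlonglongrightarrow> 0 + 0"
    using prob_sample_variance_small[OF sq var] Z.prob_some_large[OF sqZ \<eta>]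
    unfolding v_def by (rule tendsto_add)
  then have "(\<lambda>n. prob (?A n) + prob (?B n)) \<longlonglongrightarrow> 0" by simp
  then show ?thesis
    by (rule Lim_null_comparison[rotated])
       (simp only: real_norm_def abs_of_nonneg measure_nonneg le eventually_True)
qed

end

section \<open>Conditioning on the data\<close>

text \<open>
  Fubini's theorem on the joint law, pulled back to the underlying space. The inner expectation is
  the conditional expectation given \<open>U\<close>.
\<close>

lemma (in prob_space) expectation_indep_var:
  fixes F :: "'b \<times> 'b \<Rightarrow> real"
  assumes indep: "indep_var S U T V"
    and [measurable]: "F \<in> borel_measurable (S \<Otimes>\<^sub>M T)" and bound: "\<And>p. \<bar>F p\<bar> \<le> C"
  shows "expectation (\<lambda>\<omega>. F (U \<omega>, V \<omega>)) = expectation (\<lambda>\<omega>. expectation (\<lambda>\<omega>'. F (U \<omega>, V \<omega>')))"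
proof -
  have [measurable]: "random_variable S U" "random_variable T V"
    and distr: "distr M S U \<Otimes>\<^sub>M distr M T V = distr M (S \<Otimes>\<^sub>M T) (\<lambda>\<omega>. (U \<omega>, V \<omega>))"
    using indep unfolding indep_var_distribution_eq by auto
  interpret U: prob_space "distr M S U" by (rule prob_space_distr) simp
  interpret V: prob_space "distr M T V" by (rule prob_space_distr) simp
  interpret UV: pair_prob_space "distr M S U" "distr M T V" ..
  have int: "integrable (distr M S U \<Otimes>\<^sub>M distr M T V) F"
    by (rule UV.P.integrable_const_bound[of _ C]) (use bound in auto)
  have "expectation (\<lambda>\<omega>. F (U \<omega>, V \<omega>)) = integral\<^sup>L (distr M S U \<Otimes>\<^sub>M distr M T V) F"
    unfolding distr by (rule integral_distr[symmetric]) measurable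
  also have "\<dots> = (LINT u|distr M S U. LINT v|distr M T V. F (u, v))"
    using UV.integral_fst'[OF int] by simp
  also have "\<dots> = (LINT u|distr M S U. expectation (\<lambda>\<omega>'. F (u, V \<omega>')))"
    by (intro Bochner_Integration.integral_cong refl integral_distr) (auto intro: measurable_Pair2)
  also have "\<dots> = expectation (\<lambda>\<omega>. expectation (\<lambda>\<omega>'. F (U \<omega>, V \<omega>')))"
    by (rule integral_distr) measurable
  finally show ?thesis .
qed

abbreviation sequences :: "(nat \<Rightarrow> real) measure" where
  "sequences \<equiv> PiM UNIV (\<lambda>_. borel)"

lemma T_star_measurable_pair [measurable]:
  "(\<lambda>p. T_star n (fst p) (snd p)) \<in> borel_measurable (sequences \<Otimes>\<^sub>M sequences)"
  unfolding T_star_def total_weight_def sample_sd_def sample_mean_def by measurable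

locale data_and_weights = prob_space M for M :: "'a measure" +
  fixes X :: "nat \<Rightarrow> 'a \<Rightarrow> real" and \<zeta> :: "nat \<Rightarrow> nat \<Rightarrow> 'a \<Rightarrow> real"
  assumes iid: "iid_data_and_weights M X \<zeta>"
begin

definition joint :: "nat + nat \<times> nat \<Rightarrow> 'a \<Rightarrow> real" where
  "joint j = (case j of Inl i \<Rightarrow> X i | Inr (b, i) \<Rightarrow> \<zeta> b i)"

lemma joint_simps [simp]: "joint (Inl i) = X i" "joint (Inr (b, i)) = \<zeta> b i"
  by (simp_all add: joint_def)

lemma indep_joint: "indep_vars (\<lambda>_. borel) joint UNIV"
  using iid unfolding iid_data_and_weights_def joint_def[abs_def] by blast

text \<open>
  Each value \<open>joint (f i)\<close> is read off from the block \<open>{f i}\<close>, and the blocks are disjoint.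
\<close>

lemma indep_vars_joint_inj:
  assumes "inj f"
  shows "indep_vars (\<lambda>_. borel) (\<lambda>i :: nat. joint (f i)) UNIV"
proof -
  have "indep_vars (\<lambda>i. PiM {f i} (\<lambda>_. borel)) (\<lambda>i \<omega>. restrict (\<lambda>j. joint j \<omega>) {f i}) UNIV"
    by (rule indep_vars_restrict[OF indep_joint]) (use assms in \<open>auto simp: disjoint_family_on_def inj_def\<close>)
  then have "indep_vars (\<lambda>_. borel) (\<lambda>i \<omega>. (restrict (\<lambda>j. joint j \<omega>) {f i}) (f i)) UNIV"
    by (rule indep_vars_compose2) (rule measurable_component_singleton, simp)
  then show ?thesis by simp
qed

lemma data_iid: "iid_sequence M X"
proof
  show "indep_vars (\<lambda>_. borel) X UNIV"
    using indep_vars_joint_inj[of Inl] by simp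
  show "distr M borel (X i) = distr M borel (X 0)" for i
    using iid unfolding iid_data_and_weights_def by blast
qed

lemma weights_ident: "distr M borel (\<zeta> b i) = distr M borel (\<zeta> 0 0)"
  using iid unfolding iid_data_and_weights_def by blast

lemma weights_iid: "iid_sequence M (\<zeta> b)"
proof
  show "indep_vars (\<lambda>_. borel) (\<zeta> b) UNIV"
    using indep_vars_joint_inj[of "\<lambda>i. Inr (b, i)"] by (simp add: inj_def)
  show "distr M borel (\<zeta> b i) = distr M borel (\<zeta> b 0)" for i
    using weights_ident[of b i] weights_ident[of b 0] by simp
qed

lemma data_measurable [measurable]: "random_variable borel (X i)"
  by (rule iid_sequence.rv[OF data_iid])

lemma weight_measurable [measurable]: "random_variable borel (\<zeta> b i)"
  by (rule iid_sequence.rv[OF weights_iid])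

lemma data_sequence_measurable [measurable]: "random_variable sequences (\<lambda>\<omega> i. X i \<omega>)"
  by (rule measurable_PiM_single') auto

lemma weight_sequence_measurable [measurable]: "random_variable sequences (\<lambda>\<omega> i. \<zeta> b i \<omega>)"
  by (rule measurable_PiM_single') auto

lemma weight_sequence_ident:
  "distr M sequences (\<lambda>\<omega> i. \<zeta> b i \<omega>) = distr M sequences (\<lambda>\<omega> i. \<zeta> 0 i \<omega>)"
proof -
  have "distr M sequences (\<lambda>\<omega> i. \<zeta> b i \<omega>) = PiM UNIV (\<lambda>_. distr M borel (\<zeta> 0 0))" for b
  proof -
    interpret W: iid_sequence M "\<zeta> b" by (rule weights_iid)
    have "distr M sequences (\<lambda>\<omega>. \<lambda>i\<in>UNIV. \<zeta> b i \<omega>) = PiM UNIV (\<lambda>i. distr M borel (\<zeta> b i))"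
      using W.indep by (subst indep_vars_iff_distr_eq_PiM[symmetric]) auto
    then show ?thesis by (simp add: weights_ident[of b] restrict_UNIV)
  qed
  then show ?thesis by metis
qed

lemma block_measurable:
  assumes "range f \<subseteq> A"
  shows "(\<lambda>u i. u (f i)) \<in> measurable (PiM A (\<lambda>_. borel)) sequences"
  using assms by (intro measurable_PiM_single') (auto intro!: measurable_component_singleton)

lemma indep_data_weights: "indep_var sequences (\<lambda>\<omega> i. X i \<omega>) sequences (\<lambda>\<omega> i. \<zeta> b i \<omega>)"
proof -
  let ?A = "range Inl :: (nat + nat \<times> nat) set" and ?B = "range (\<lambda>i. Inr (b, i)) :: (nat + nat \<times> nat) set"
  have "indep_var sequences ((\<lambda>f i. f (Inl i)) \<circ> (\<lambda>\<omega>. restrict (\<lambda>j. joint j \<omega>) ?A))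
      sequences ((\<lambda>f i. f (Inr (b, i))) \<circ> (\<lambda>\<omega>. restrict (\<lambda>j. joint j \<omega>) ?B))"
    by (rule indep_var_compose[OF indep_var_restrict[OF indep_joint]])
       (auto intro!: block_measurable)
  then show ?thesis by (simp add: comp_def)
qed

text \<open>
  Given the data, the statistics of two different bootstrap samples are independent with the same
  law, so the conditional expectation of the product is the square of \<open>g\<close>. Conditioning is carried
  out in two steps, first on the data together with \<open>\<zeta> b\<close> and then on the data alone.
\<close>

lemma expectation_two_weight_sequences:
  fixes h :: "(nat \<Rightarrow> real) \<times> (nat \<Rightarrow> real) \<Rightarrow> real"
  assumes [measurable]: "h \<in> borel_measurable (sequences \<Otimes>\<^sub>M sequences)" and bound: "\<And>p. \<bar>h p\<bar> \<le> 1"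
    and "b \<noteq> b'"
  defines "g \<equiv> \<lambda>x. expectation (\<lambda>\<omega>. h (x, \<lambda>i. \<zeta> 0 i \<omega>))"
  shows "expectation (\<lambda>\<omega>. h (\<lambda>i. X i \<omega>, \<lambda>i. \<zeta> b i \<omega>) * h (\<lambda>i. X i \<omega>, \<lambda>i. \<zeta> b' i \<omega>))
    = expectation (\<lambda>\<omega>. (g (\<lambda>i. X i \<omega>))\<^sup>2)"
proof -
  have g_eq: "expectation (\<lambda>\<omega>. h (x, \<lambda>i. \<zeta> c i \<omega>)) = g x" for c x
  proof -
    have x: "x \<in> space sequences" by (simp add: space_PiM)
    have [measurable]: "(\<lambda>w. h (x, w)) \<in> borel_measurable sequences"
      using x by measurable
    have "expectation (\<lambda>\<omega>. h (x, \<lambda>i. \<zeta> c i \<omega>)) = (LINT w|distr M sequences (\<lambda>\<omega> i. \<zeta> c i \<omega>). h (x, w))"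
      by (rule integral_distr[symmetric]) measurable
    also have "\<dots> = g x"
      unfolding weight_sequence_ident[of c] g_def by (rule integral_distr) measurable
    finally show ?thesis .
  qed
  have g_meas [measurable]: "g \<in> borel_measurable sequences"
    unfolding g_def by measurable
  have g_bound: "\<bar>g x\<bar> \<le> 1" for x
  proof -
    have x: "x \<in> space sequences" by (simp add: space_PiM)
    have [measurable]: "(\<lambda>\<omega>. h (x, \<lambda>i. \<zeta> 0 i \<omega>)) \<in> borel_measurable M" using x by measurable
    have "integrable M (\<lambda>\<omega>. h (x, \<lambda>i. \<zeta> 0 i \<omega>))"
      by (rule integrable_const_bound[of _ 1]) (use bound in auto)
    then have "\<bar>g x\<bar> \<le> expectation (\<lambda>\<omega>. 1)"
      unfolding g_def by (intro order_trans[OF integral_abs_bound] integral_mono) (use bound in auto)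
    then show ?thesis by (simp add: prob_space)
  qed
  have prod_bound: "\<bar>a * c\<bar> \<le> 1" if "\<bar>a\<bar> \<le> 1" "\<bar>c\<bar> \<le> 1" for a c :: real
    using that by (simp add: abs_mult mult_le_one)
  have "expectation (\<lambda>\<omega>. h (\<lambda>i. X i \<omega>, \<lambda>i. \<zeta> b i \<omega>) * h (\<lambda>i. X i \<omega>, \<lambda>i. \<zeta> b' i \<omega>))
      = expectation (\<lambda>\<omega>. h (\<lambda>i. X i \<omega>, \<lambda>i. \<zeta> b i \<omega>) * g (\<lambda>i. X i \<omega>))"
  proof -
    \<comment> \<open>\<open>indep_var\<close> relates variables with values in one type, so the pair of data and \<open>\<zeta> b\<close> and
      the single sequence \<open>\<zeta> b'\<close> both enter as blocks of \<open>joint\<close>\<close>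
    let ?A = "range Inl \<union> range (\<lambda>i. Inr (b, i)) :: (nat + nat \<times> nat) set"
      and ?B = "range (\<lambda>i. Inr (b', i)) :: (nat + nat \<times> nat) set"
    let ?F = "\<lambda>p. h (\<lambda>i. fst p (Inl i), \<lambda>i. fst p (Inr (b, i))) * h (\<lambda>i. fst p (Inl i), \<lambda>i. snd p (Inr (b', i)))"
    let ?P = "\<lambda>C. PiM C (\<lambda>_. borel) :: (nat + nat \<times> nat \<Rightarrow> real) measure"
    have [measurable]:
      "(\<lambda>p. \<lambda>i. fst p (Inl i)) \<in> measurable (?P ?A \<Otimes>\<^sub>M ?P ?B) sequences"
      "(\<lambda>p. \<lambda>i. fst p (Inr (b, i))) \<in> measurable (?P ?A \<Otimes>\<^sub>M ?P ?B) sequences"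
      "(\<lambda>p. \<lambda>i. snd p (Inr (b', i))) \<in> measurable (?P ?A \<Otimes>\<^sub>M ?P ?B) sequences"
      by (rule measurable_compose[OF measurable_fst block_measurable]
          measurable_compose[OF measurable_snd block_measurable]; auto)+
    have "indep_var (?P ?A) (\<lambda>\<omega>. restrict (\<lambda>j. joint j \<omega>) ?A) (?P ?B) (\<lambda>\<omega>. restrict (\<lambda>j. joint j \<omega>) ?B)"
      by (rule indep_var_restrict[OF indep_joint]) (use \<open>b \<noteq> b'\<close> in auto)
    from expectation_indep_var[OF this, of ?F 1] show ?thesis
      using prod_bound[OF bound bound] by (simp add: g_eq)
  qed
  also have "\<dots> = expectation (\<lambda>\<omega>. (g (\<lambda>i. X i \<omega>))\<^sup>2)"
    using expectation_indep_var[OF indep_data_weights[of b], of "\<lambda>p. h p * g (fst p)" 1]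
      prod_bound[OF bound g_bound]
    by (simp add: g_eq power2_eq_square)
  finally show ?thesis .
qed

end

section \<open>The bootstrap distribution function\<close>

definition boot_cdf :: "nat \<Rightarrow> nat \<Rightarrow> (nat \<Rightarrow> real) \<Rightarrow> (nat \<Rightarrow> nat \<Rightarrow> real) \<Rightarrow> real \<Rightarrow> real" where
  "boot_cdf n B x w t = (1 / real B) * (\<Sum>b<B. of_bool (T_star n x (w b) \<le> t))"

context data_and_weights
begin

lemma T_star_random_variable [measurable]:
  "random_variable borel (\<lambda>\<omega>. T_star n (\<lambda>i. X i \<omega>) (\<lambda>i. \<zeta> b i \<omega>))"
  unfolding T_star_def total_weight_def sample_sd_def sample_mean_def by measurable

lemma boot_cdf_measurable [measurable]:
  "random_variable borel (\<lambda>\<omega>. boot_cdf n B (\<lambda>i. X i \<omega>) (\<lambda>b i. \<zeta> b i \<omega>) t)"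
  unfolding boot_cdf_def by measurable

text \<open>
  Let \<open>\<Phi>\<close> be the normal distribution function at \<open>t\<close> and \<open>g n\<close> the conditional
  expectation of \<open>of_bool (T_star \<le> t) - \<Phi>\<close> given the data. In the
  second moment of \<open>boot_cdf - \<Phi>\<close> the \<open>B\<close> diagonal terms contribute at most \<open>1/B\<close> and each of the
  others \<open>a n\<close>, the second moment of \<open>g n\<close>, divided by \<open>B\<^sup>2\<close>. By the uniform limit theorem
  \<open>\<bar>g n\<bar>\<close> is small except on data of vanishing probability, where it is at most \<open>1\<close>. The bound
  \<open>1/B + a n\<close> separates the variables, so \<open>n\<close> and \<open>B\<close> may tend to infinity at unrelated rates.
\<close>

lemma boot_cdf_tendsto:
  assumes sqX: "integrable M (\<lambda>\<omega>. (X 0 \<omega>)\<^sup>2)" and varX: "0 < variance (X 0)"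
    and pos: "\<And>b i. AE \<omega> in M. 0 < \<zeta> b i \<omega>"
    and sqW: "integrable M (\<lambda>\<omega>. (\<zeta> 0 0 \<omega>)\<^sup>2)" and varW: "0 < variance (\<zeta> 0 0)"
    and c: "0 < c"
  shows "((\<lambda>(n, B). prob {\<omega> \<in> space M.
      c \<le> \<bar>boot_cdf n B (\<lambda>i. X i \<omega>) (\<lambda>b i. \<zeta> b i \<omega>) t - cdf std_normal_distribution t\<bar>}) \<longlongrightarrow> 0)
      (sequentially \<times>\<^sub>F sequentially)"
proof -
  interpret D: iid_sequence M X by (rule data_iid)
  interpret W: iid_sequence M "\<zeta> 0" by (rule weights_iid)
  define \<Phi> where "\<Phi> = cdf std_normal_distribution t"
  have \<Phi>: "0 \<le> \<Phi>" "\<Phi> \<le> 1"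
  proof -
    interpret N: real_distribution std_normal_distribution by (rule real_dist_normal_dist)
    show "0 \<le> \<Phi>" "\<Phi> \<le> 1" unfolding \<Phi>_def by (rule N.cdf_nonneg, rule N.cdf_bounded_prob)
  qed
  define h where "h n p = of_bool (T_star n (fst p) (snd p) \<le> t) - \<Phi>" for n p
  have [measurable]: "h n \<in> borel_measurable (sequences \<Otimes>\<^sub>M sequences)" for n
    unfolding h_def by measurable
  have h_bound: "\<bar>h n p\<bar> \<le> 1" for n p using \<Phi> by (auto simp: h_def)
  define g where "g n x = expectation (\<lambda>\<omega>. h n (x, \<lambda>i. \<zeta> 0 i \<omega>))" for n x
  have g_eq: "g n x = prob {\<omega> \<in> space M. T_star n x (\<lambda>i. \<zeta> 0 i \<omega>) \<le> t} - \<Phi>" for n x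
  proof -
    let ?A = "{\<omega> \<in> space M. T_star n x (\<lambda>i. \<zeta> 0 i \<omega>) \<le> t}"
    have A: "?A \<in> events" by measurable
    have "g n x = expectation (\<lambda>\<omega>. indicator ?A \<omega> - \<Phi>)"
      unfolding g_def h_def by (intro Bochner_Integration.integral_cong) (auto simp: indicator_def)
    also have "\<dots> = expectation (\<lambda>\<omega>. indicator ?A \<omega>) - expectation (\<lambda>\<omega>. \<Phi>)"
    proof (rule Bochner_Integration.integral_diff)
      show "integrable M (\<lambda>\<omega>. indicator ?A \<omega> :: real)"
        by (rule integrable_real_indicator[OF A]) (simp add: emeasure_eq_measure)
    qed simp
    also have "\<dots> = prob ?A - \<Phi>" using A by (simp add: prob_space)
    finally show ?thesis .
  qed
  have [measurable]: "g n \<in> borel_measurable sequences" for n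
    unfolding g_def by measurable
  have g_bound: "(g n x)\<^sup>2 \<le> 1" for n x
  proof -
    have "\<bar>g n x\<bar> \<le> 1"
      unfolding g_eq using \<Phi> prob_le_1[of "{\<omega> \<in> space M. T_star n x (\<lambda>i. \<zeta> 0 i \<omega>) \<le> t}"]
        measure_nonneg[of M "{\<omega> \<in> space M. T_star n x (\<lambda>i. \<zeta> 0 i \<omega>) \<le> t}"] by linarith
    then show ?thesis by (simp add: abs_square_le_1)
  qed
  define a where "a n = expectation (\<lambda>\<omega>. (g n (\<lambda>i. X i \<omega>))\<^sup>2)" for n
  have g_int: "integrable M (\<lambda>\<omega>. (g n (\<lambda>i. X i \<omega>))\<^sup>2)" for n
    by (rule integrable_const_bound[of _ 1]) (use g_bound in auto)
  have a0: "0 \<le> a n" for n unfolding a_def by simp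
  have a: "a \<longlonglongrightarrow> 0"
  proof (rule LIMSEQ_I)
    fix e :: real assume e: "0 < e"
    define \<epsilon> where "\<epsilon> = sqrt (e / 2)"
    have \<epsilon>: "0 < \<epsilon>" "\<epsilon>\<^sup>2 = e / 2" using e by (simp_all add: \<epsilon>_def)
    obtain \<delta> n0 where \<delta>: "0 < \<delta>" and clt: "\<And>n x. n0 \<le> n \<Longrightarrow> 0 < sample_sd n x \<Longrightarrow>
        (\<forall>i<n. \<bar>studentized n x i\<bar> \<le> \<delta>) \<Longrightarrow> \<bar>g n x\<bar> < \<epsilon>"
      using W.T_star_clt_uniform[OF sqW varW pos \<epsilon>(1), of t] unfolding g_eq \<Phi>_def by blast
    define bad where "bad n = {\<omega> \<in> space M. sample_sd n (\<lambda>i. X i \<omega>) \<le> 0 \<or> (\<exists>i<n. \<delta> < \<bar>studentized n (\<lambda>i. X i \<omega>) i\<bar>)}" for n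
    have bad_meas: "bad n \<in> events" for n
      unfolding bad_def studentized_def sample_mean_def by measurable
    have bad_int: "integrable M (\<lambda>\<omega>. indicator (bad n) \<omega> :: real)" for n
      by (rule integrable_real_indicator[OF bad_meas]) (simp add: emeasure_eq_measure)
    have "(\<lambda>n. prob (bad n)) \<longlonglongrightarrow> 0"
      unfolding bad_def by (rule D.prob_studentized_large[OF sqX varX \<delta>])
    then have "\<forall>\<^sub>F n in sequentially. prob (bad n) < e / 2"
      by (rule order_tendstoD(2)) (use e in simp)
    then obtain n1 where n1: "\<And>n. n1 \<le> n \<Longrightarrow> prob (bad n) < e / 2"
      by (auto simp: eventually_sequentially)
    have "a n < e" if n: "max n0 n1 \<le> n" for n
    proof -
      have "a n \<le> expectation (\<lambda>\<omega>. \<epsilon>\<^sup>2 + indicator (bad n) \<omega>)"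
        unfolding a_def
      proof (rule integral_mono[OF g_int])
        fix \<omega> assume \<omega>: "\<omega> \<in> space M"
        show "(g n (\<lambda>i. X i \<omega>))\<^sup>2 \<le> \<epsilon>\<^sup>2 + indicator (bad n) \<omega>"
        proof (cases "\<omega> \<in> bad n")
          case True
          then show ?thesis
            using add_mono[OF zero_le_power2[of \<epsilon>] g_bound[of n "\<lambda>i. X i \<omega>"]] by simp
        next
          case False
          with \<omega> have "\<not> (sample_sd n (\<lambda>i. X i \<omega>) \<le> 0 \<or> (\<exists>i<n. \<delta> < \<bar>studentized n (\<lambda>i. X i \<omega>) i\<bar>))"
            by (simp add: bad_def)
          then have "\<bar>g n (\<lambda>i. X i \<omega>)\<bar> < \<epsilon>"
            using n by (intro clt) (simp_all add: not_le, meson not_le)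
          then have "\<bar>g n (\<lambda>i. X i \<omega>)\<bar>\<^sup>2 \<le> \<epsilon>\<^sup>2" by (intro power_mono) auto
          then show ?thesis using False by simp
        qed
      qed (rule Bochner_Integration.integrable_add[OF integrable_const bad_int])
      also have "\<dots> = expectation (\<lambda>\<omega>. \<epsilon>\<^sup>2) + expectation (\<lambda>\<omega>. indicator (bad n) \<omega>)"
        by (rule Bochner_Integration.integral_add[OF integrable_const bad_int])
      also have "\<dots> = e / 2 + prob (bad n)"
        using bad_meas by (simp add: prob_space \<epsilon>(2))
      also have "\<dots> < e" using n1[of n] n by simp
      finally show ?thesis .
    qed
    then show "\<exists>no. \<forall>n\<ge>no. norm (a n - 0) < e"
      using a0 by (intro exI[of _ "max n0 n1"]) simp
  qed
  have bound: "prob {\<omega> \<in> space M. c \<le> \<bar>boot_cdf n B (\<lambda>i. X i \<omega>) (\<lambda>b i. \<zeta> b i \<omega>) t - \<Phi>\<bar>} \<le> (1 / B + a n) / c\<^sup>2"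
    if B: "0 < B" for n B
  proof -
    define H where "H b \<omega> = h n (\<lambda>i. X i \<omega>, \<lambda>i. \<zeta> b i \<omega>)" for b \<omega>
    have H_meas [measurable]: "random_variable borel (H b)" for b
      unfolding H_def by measurable
    have H_bound: "\<bar>H b \<omega>\<bar> \<le> 1" for b \<omega> unfolding H_def by (rule h_bound)
    have H_sq: "integrable M (\<lambda>\<omega>. (H b \<omega>)\<^sup>2)" for b
      by (rule integrable_const_bound[of _ 1]) (use H_bound in \<open>auto simp: abs_square_le_1\<close>)
    have dev: "boot_cdf n B (\<lambda>i. X i \<omega>) (\<lambda>b i. \<zeta> b i \<omega>) t - \<Phi> = (\<Sum>b<B. H b \<omega>) / B" for \<omega>
      using B by (simp add: boot_cdf_def H_def h_def sum_subtractf diff_divide_distrib)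
    note S = integral_square_sum[of H M, OF H_meas H_sq, where n = B]
    have HH: "expectation (\<lambda>\<omega>. H b \<omega> * H b' \<omega>) \<le> of_bool (b = b') + a n" for b b'
    proof (cases "b = b'")
      case True
      have "expectation (\<lambda>\<omega>. (H b \<omega>)\<^sup>2) \<le> expectation (\<lambda>\<omega>. 1)"
        using H_sq H_bound by (intro integral_mono) (auto simp: abs_square_le_1)
      then show ?thesis using True a0[of n] by (simp add: prob_space power2_eq_square)
    next
      case False
      then show ?thesis
        unfolding H_def a_def g_def
        by (subst expectation_two_weight_sequences) (use h_bound in auto)
    qed
    have "expectation (\<lambda>\<omega>. (\<Sum>b<B. H b \<omega>)\<^sup>2) \<le> (\<Sum>b<B. \<Sum>b'<B. of_bool (b = b') + a n)"
      unfolding S(2) by (intro sum_mono HH)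
    also have "\<dots> = (\<Sum>b<B. 1 + B * a n)"
      by (intro sum.cong refl) (simp add: sum.distrib sum.If_cases of_bool_def)
    also have "\<dots> = B + B\<^sup>2 * a n" by (simp add: power2_eq_square distrib_left)
    finally have E: "expectation (\<lambda>\<omega>. (\<Sum>b<B. H b \<omega>)\<^sup>2) \<le> B + B\<^sup>2 * a n" .
    have "{\<omega> \<in> space M. c \<le> \<bar>(\<Sum>b<B. H b \<omega>) / B\<bar>} = {\<omega> \<in> space M. (c * B)\<^sup>2 \<le> (\<Sum>b<B. H b \<omega>)\<^sup>2}"
    proof -
      have "c \<le> \<bar>s / B\<bar> \<longleftrightarrow> (c * B)\<^sup>2 \<le> s\<^sup>2" for s :: real
        using B c by (simp add: abs_le_square_iff[symmetric] abs_mult le_divide_eq)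
      then show ?thesis by simp
    qed
    then have "prob {\<omega> \<in> space M. c \<le> \<bar>(\<Sum>b<B. H b \<omega>) / B\<bar>} \<le> expectation (\<lambda>\<omega>. (\<Sum>b<B. H b \<omega>)\<^sup>2) / (c * B)\<^sup>2"
      using integral_Markov_inequality_measure[OF S(1), of "{}" "(c * B)\<^sup>2"] B c by simp
    also have "\<dots> \<le> (B + B\<^sup>2 * a n) / (c * B)\<^sup>2" by (rule divide_right_mono[OF E]) simp
    also have "\<dots> = (1 / B + a n) / c\<^sup>2"
      using B c by (simp add: field_simps power2_eq_square)
    finally show ?thesis unfolding dev .
  qed
  have fst: "filterlim fst sequentially (sequentially \<times>\<^sub>F sequentially)"
    and snd: "filterlim snd sequentially (sequentially \<times>\<^sub>F sequentially)"
    by (rule filterlim_fst, rule filterlim_snd)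
  have "((\<lambda>p :: nat \<times> nat. (1 / real (snd p) + a (fst p)) / c\<^sup>2) \<longlongrightarrow> (0 + 0) / c\<^sup>2) (sequentially \<times>\<^sub>F sequentially)"
    using c by (intro tendsto_divide tendsto_add tendsto_const
        filterlim_compose[OF lim_1_over_n snd] filterlim_compose[OF a fst]) simp
  then have lim: "((\<lambda>p :: nat \<times> nat. (1 / real (snd p) + a (fst p)) / c\<^sup>2) \<longlongrightarrow> 0) (sequentially \<times>\<^sub>F sequentially)"
    by simp
  have "\<forall>\<^sub>F p in sequentially \<times>\<^sub>F sequentially. 0 < snd p"
    using snd eventually_gt_at_top[of 0] by (simp add: filterlim_iff)
  then have "\<forall>\<^sub>F p in sequentially \<times>\<^sub>F sequentially. norm (prob {\<omega> \<in> space M.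
      c \<le> \<bar>boot_cdf (fst p) (snd p) (\<lambda>i. X i \<omega>) (\<lambda>b i. \<zeta> b i \<omega>) t - \<Phi>\<bar>}) \<le> (1 / snd p + a (fst p)) / c\<^sup>2"
    by eventually_elim (use bound in simp)
  from Lim_null_comparison[OF this lim] show ?thesis
    unfolding \<Phi>_def by (simp add: case_prod_unfold)
qed

end

section \<open>From distribution functions to quantiles\<close>

lemma boot_cdf_mono: "s \<le> t \<Longrightarrow> boot_cdf n B x w s \<le> boot_cdf n B x w t"
  unfolding boot_cdf_def by (intro mult_left_mono sum_mono) auto

text \<open>
  The largest of the \<open>B\<close> statistics belongs to the set, because there \<open>boot_cdf\<close> is \<open>1\<close>; the
  smallest one is a lower bound, because below it \<open>boot_cdf\<close> is \<open>0\<close>.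
\<close>

lemma C_boot_set_nonempty_bdd_below:
  assumes "0 < B" "0 < \<alpha>" "\<alpha> \<le> 1"
  shows "{t. \<alpha> \<le> boot_cdf n B x w t} \<noteq> {}" "bdd_below {t. \<alpha> \<le> boot_cdf n B x w t}"
proof -
  let ?T = "(\<lambda>b. T_star n x (w b)) ` {..<B}"
  have T: "finite ?T" "?T \<noteq> {}" using assms by auto
  have "boot_cdf n B x w (Max ?T) = 1 / real B * (\<Sum>b<B. 1)"
    unfolding boot_cdf_def by (intro arg_cong2[where f = "(*)"] sum.cong refl) (simp add: T)
  then have "\<alpha> \<le> boot_cdf n B x w (Max ?T)" using assms by simp
  then show "{t. \<alpha> \<le> boot_cdf n B x w t} \<noteq> {}" by blast
  show "bdd_below {t. \<alpha> \<le> boot_cdf n B x w t}"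
  proof (rule bdd_belowI)
    fix t assume "t \<in> {t. \<alpha> \<le> boot_cdf n B x w t}"
    then have "boot_cdf n B x w t \<noteq> 0" using assms by auto
    then obtain b where "b < B" "T_star n x (w b) \<le> t"
      unfolding boot_cdf_def by (auto elim!: sum.not_neutral_contains_not_neutral split: if_splits)
    then show "Min ?T \<le> t" using T by (auto simp: Min_le_iff)
  qed
qed

lemma C_boot_less_imp:
  assumes "0 < B" "0 < \<alpha>" "\<alpha> \<le> 1" and "C_boot \<alpha> n B x w < t"
  shows "\<alpha> \<le> boot_cdf n B x w t"
proof -
  have "Inf {t. \<alpha> \<le> boot_cdf n B x w t} < t"
    using assms(4) unfolding C_boot_def boot_cdf_def .
  then obtain s where "\<alpha> \<le> boot_cdf n B x w s" "s < t"
    using cInf_less_iff[OF C_boot_set_nonempty_bdd_below[OF assms(1-3)]] by auto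
  then show ?thesis using boot_cdf_mono[of s t n B x w] by simp
qed

lemma C_boot_le:
  assumes "0 < B" "0 < \<alpha>" "\<alpha> \<le> 1" and "\<alpha> \<le> boot_cdf n B x w t"
  shows "C_boot \<alpha> n B x w \<le> t"
proof -
  have "Inf {t. \<alpha> \<le> boot_cdf n B x w t} \<le> t"
    using assms by (intro cInf_lower C_boot_set_nonempty_bdd_below) auto
  then show ?thesis unfolding C_boot_def boot_cdf_def .
qed

text \<open>
  By monotonicity \<open>C_boot < u\<close> is witnessed by a rational argument of \<open>boot_cdf\<close>, which makes it a
  countable union of events.
\<close>

lemma (in data_and_weights) C_boot_measurable:
  assumes "0 < \<alpha>" "\<alpha> \<le> 1"
  shows "random_variable borel (\<lambda>\<omega>. C_boot \<alpha> n B (\<lambda>i. X i \<omega>) (\<lambda>b i. \<zeta> b i \<omega>))"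
proof (cases "B = 0")
  case True
  then show ?thesis by (simp add: C_boot_def)
next
  case False
  then have B: "0 < B" by simp
  let ?C = "\<lambda>\<omega>. C_boot \<alpha> n B (\<lambda>i. X i \<omega>) (\<lambda>b i. \<zeta> b i \<omega>)"
    and ?G = "\<lambda>\<omega>. boot_cdf n B (\<lambda>i. X i \<omega>) (\<lambda>b i. \<zeta> b i \<omega>)"
  have "?C \<omega> < u \<longleftrightarrow> (\<exists>q :: rat. of_rat q < u \<and> \<alpha> \<le> ?G \<omega> (of_rat q))" for \<omega> u
  proof
    assume "?C \<omega> < u"
    then obtain q where "?C \<omega> < of_rat q" "of_rat q < u" using of_rat_dense by blast
    then show "\<exists>q :: rat. of_rat q < u \<and> \<alpha> \<le> ?G \<omega> (of_rat q)"
      using C_boot_less_imp[OF B assms] by blast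
  next
    assume "\<exists>q :: rat. of_rat q < u \<and> \<alpha> \<le> ?G \<omega> (of_rat q)"
    then show "?C \<omega> < u" using C_boot_le[OF B assms] by (meson le_less_trans)
  qed
  then have "{\<omega> \<in> space M. ?C \<omega> < u} = {\<omega> \<in> space M. \<exists>q :: rat. of_rat q < u \<and> \<alpha> \<le> ?G \<omega> (of_rat q)}" for u
    by simp
  also have "\<dots> u \<in> events" for u by measurable
  finally show ?thesis by (simp add: borel_measurable_iff_less)
qed

text \<open>
  For \<open>z = \<infinity>\<close>, where \<open>\<alpha> = 1\<close>, only the first conclusion has content.
\<close>

lemma std_normal_quantile:
  assumes "measure std_normal_distribution {x. ereal x \<le> z} = \<alpha>"
  shows "ereal t < z \<Longrightarrow> cdf std_normal_distribution t < \<alpha>"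
    and "z < ereal t \<Longrightarrow> \<alpha> < cdf std_normal_distribution t"
proof -
  interpret N: real_distribution std_normal_distribution by (rule real_dist_normal_dist)
  have meas: "{x. ereal x \<le> z} \<in> sets std_normal_distribution"
    by (cases z) (simp_all add: atMost_def[symmetric])
  show "cdf std_normal_distribution t < \<alpha>" if t: "ereal t < z"
  proof -
    obtain s where s: "t < s" "ereal s < z" using ereal_dense2[OF t] by auto
    have "cdf std_normal_distribution t < cdf std_normal_distribution s"
      by (rule cdf_std_normal_strict_mono[OF s(1)])
    also have "\<dots> \<le> \<alpha>"
      unfolding cdf_def assms[symmetric]
    proof (rule N.finite_measure_mono[OF _ meas], rule subsetI)
      fix x assume "x \<in> {..s}"
      then have "ereal x \<le> ereal s" by simp
      also have "\<dots> \<le> z" using s(2) by (rule less_imp_le)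
      finally show "x \<in> {x. ereal x \<le> z}" by simp
    qed
    finally show ?thesis .
  qed
  show "\<alpha> < cdf std_normal_distribution t" if t: "z < ereal t"
  proof -
    obtain s where s: "z < ereal s" "s < t" using ereal_dense2[OF t] by auto
    have "\<alpha> \<le> cdf std_normal_distribution s"
      unfolding cdf_def assms[symmetric]
    proof (rule N.finite_measure_mono, rule subsetI)
      fix x assume "x \<in> {x. ereal x \<le> z}"
      then have "ereal x < ereal s" using s(1) by (metis le_less_trans mem_Collect_eq)
      then show "x \<in> {..s}" by simp
    qed simp
    also have "\<dots> < cdf std_normal_distribution t"
      by (rule cdf_std_normal_strict_mono[OF s(2)])
    finally show ?thesis .
  qed
qed

text \<open>
  One-sided bounds suffice, and in this form the case \<open>c = \<infinity>\<close> requires no separate treatment later: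
  the condition on \<open>u\<close> is then vacuous.
\<close>

lemma tendsto_in_probI:
  fixes Y :: "'i \<Rightarrow> 'a \<Rightarrow> real" and c :: ereal
  assumes "prob_space M" and c: "- \<infinity> < c"
    and [measurable]: "\<And>i. Y i \<in> borel_measurable M"
    and lower: "\<And>l. ereal l < c \<Longrightarrow> ((\<lambda>i. measure M {\<omega> \<in> space M. Y i \<omega> \<le> l}) \<longlongrightarrow> 0) F"
    and upper: "\<And>u. c < ereal u \<Longrightarrow> ((\<lambda>i. measure M {\<omega> \<in> space M. u \<le> Y i \<omega>}) \<longlongrightarrow> 0) F"
  shows "tendsto_in_prob M (\<lambda>i \<omega>. ereal (Y i \<omega>)) c F"
  unfolding tendsto_in_prob_def
proof (intro conjI allI impI)
  interpret prob_space M by fact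
  show "(\<lambda>\<omega>. ereal (Y i \<omega>)) \<in> borel_measurable M" for i by measurable
  fix U :: "ereal set" assume U: "open U" "c \<in> U"
  have [measurable]: "{\<omega> \<in> space M. ereal (Y i \<omega>) \<notin> U} \<in> events" for i
    using borel_open[OF U(1)] by measurable
  obtain l' where l': "l' < c" "{l'<..c} \<subseteq> U"
    using open_left[OF U c] by blast
  obtain l where l: "l' < ereal l" "ereal l < c" using ereal_dense2[OF l'(1)] by blast
  show "((\<lambda>i. prob {\<omega> \<in> space M. ereal (Y i \<omega>) \<notin> U}) \<longlongrightarrow> 0) F"
  proof (cases "c = \<infinity>")
    case True
    have "{\<omega> \<in> space M. ereal (Y i \<omega>) \<notin> U} \<subseteq> {\<omega> \<in> space M. Y i \<omega> \<le> l}" for i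
    proof -
      have "y \<in> U" if "l < y" for y
        using l'(2) l(1) True that by (auto intro!: subsetD[OF l'(2)] less_trans[OF l(1)])
      then show ?thesis by (auto simp: not_le[symmetric])
    qed
    then have "prob {\<omega> \<in> space M. ereal (Y i \<omega>) \<notin> U} \<le> prob {\<omega> \<in> space M. Y i \<omega> \<le> l}" for i
      by (rule finite_measure_mono) measurable
    then show ?thesis
      by (intro Lim_null_comparison[OF always_eventually lower[OF l(2)]]) simp
  next
    case False
    then obtain u' where u': "c < u'" "{c..<u'} \<subseteq> U"
      using open_right[OF U, of \<infinity>] by (auto simp: less_top)
    obtain u where u: "c < ereal u" "ereal u < u'" using ereal_dense2[OF u'(1)] by blast
    have "{\<omega> \<in> space M. ereal (Y i \<omega>) \<notin> U} \<subseteq> {\<omega> \<in> space M. Y i \<omega> \<le> l} \<union> {\<omega> \<in> space M. u \<le> Y i \<omega>}" for i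
    proof -
      have "ereal y \<in> U" if "l < y" "y < u" for y
      proof (cases "ereal y \<le> c")
        case True
        have "l' < ereal y" using l(1) that(1) by (meson less_ereal.simps(1) less_trans)
        then show ?thesis using True l'(2) by auto
      next
        case False
        have "ereal y < u'" using u(2) that(2) by (meson less_ereal.simps(1) less_trans)
        then show ?thesis using False u'(2) by auto
      qed
      then show ?thesis by (auto simp: not_le[symmetric])
    qed
    then have "prob {\<omega> \<in> space M. ereal (Y i \<omega>) \<notin> U}
        \<le> prob ({\<omega> \<in> space M. Y i \<omega> \<le> l} \<union> {\<omega> \<in> space M. u \<le> Y i \<omega>})" for i
      by (rule finite_measure_mono) measurable
    also have "\<dots> i \<le> prob {\<omega> \<in> space M. Y i \<omega> \<le> l} + prob {\<omega> \<in> space M. u \<le> Y i \<omega>}" for i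
      by (rule measure_Un_le; measurable)
    finally have le: "prob {\<omega> \<in> space M. ereal (Y i \<omega>) \<notin> U}
        \<le> prob {\<omega> \<in> space M. Y i \<omega> \<le> l} + prob {\<omega> \<in> space M. u \<le> Y i \<omega>}" for i .
    have "((\<lambda>i. prob {\<omega> \<in> space M. Y i \<omega> \<le> l} + prob {\<omega> \<in> space M. u \<le> Y i \<omega>}) \<longlongrightarrow> 0 + 0) F"
      by (intro tendsto_add lower upper l u)
    then have "((\<lambda>i. prob {\<omega> \<in> space M. Y i \<omega> \<le> l} + prob {\<omega> \<in> space M. u \<le> Y i \<omega>}) \<longlongrightarrow> 0) F" by simp
    then show ?thesis
      by (rule Lim_null_comparison[rotated]) (simp add: le)
  qed
qed

text \<open>
  For real \<open>t < z\<close> the normal distribution function at \<open>t\<close> is less than \<open>\<alpha>\<close>, so if the bootstrap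
  quantile lies below \<open>t\<close>, then the bootstrap distribution function at \<open>t\<close> is at least \<open>\<alpha>\<close> and
  exceeds its limit by a fixed amount, which has vanishing probability; likewise on the other side
  of \<open>z\<close>.
\<close>

theorem theorem4p2:
  fixes M :: "'a measure"
    and X :: "nat \<Rightarrow> 'a \<Rightarrow> real"
    and \<zeta> :: "nat \<Rightarrow> nat \<Rightarrow> 'a \<Rightarrow> real"
    and \<alpha> :: real and z :: ereal
  assumes "prob_space M"
    and "iid_data_and_weights M X \<zeta>"
    and "integrable M (\<lambda>\<omega>. (X 0 \<omega>)\<^sup>2)"
    and "prob_space.variance M (X 0) > 0"
    and "\<And>b i. AE \<omega> in M. 0 < \<zeta> b i \<omega>"
    and "\<not> (\<exists>c. AE \<omega> in M. \<zeta> 0 0 \<omega> = c)"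
    and "integrable M (\<lambda>\<omega>. (\<zeta> 0 0 \<omega>)\<^sup>2)"
    and "0 < \<alpha>" and "\<alpha> \<le> 1"
    and "measure std_normal_distribution {x. ereal x \<le> z} = \<alpha>"
  shows "tendsto_in_prob M
           (\<lambda>(n, B) \<omega>. ereal (C_boot \<alpha> n B (\<lambda>i. X i \<omega>) (\<lambda>b i. \<zeta> b i \<omega>)))
           z (sequentially \<times>\<^sub>F sequentially)"
proof -
  interpret prob_space M by fact
  interpret data_and_weights M X \<zeta> by unfold_locales fact
  have varW: "0 < variance (\<zeta> 0 0)"
  proof -
    have int: "integrable M (\<zeta> 0 0)"
      by (rule square_integrable_imp_integrable[OF _ assms(7)]) simp
    have "integrable M (\<lambda>\<omega>. (\<zeta> 0 0 \<omega> - expectation (\<zeta> 0 0))\<^sup>2)"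
      using int assms(7) by (simp add: power2_diff)
    moreover have "\<not> (AE \<omega> in M. (\<zeta> 0 0 \<omega> - expectation (\<zeta> 0 0))\<^sup>2 = 0)"
      using assms(6) by simp
    ultimately have "variance (\<zeta> 0 0) \<noteq> 0"
      by (subst integral_nonneg_eq_0_iff_AE) simp_all
    then show ?thesis using variance_positive[of "\<zeta> 0 0"] by linarith
  qed
  let ?F = "sequentially \<times>\<^sub>F sequentially :: (nat \<times> nat) filter"
  let ?C = "\<lambda>p \<omega>. C_boot \<alpha> (fst p) (snd p) (\<lambda>i. X i \<omega>) (\<lambda>b i. \<zeta> b i \<omega>)"
    and ?G = "\<lambda>p \<omega>. boot_cdf (fst p) (snd p) (\<lambda>i. X i \<omega>) (\<lambda>b i. \<zeta> b i \<omega>)"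
    and ?\<Phi> = "cdf std_normal_distribution"
  have B: "\<forall>\<^sub>F p in ?F. 0 < snd p"
    using filterlim_snd[of sequentially sequentially] eventually_gt_at_top[of 0] by (simp add: filterlim_iff)
  note quantile = std_normal_quantile[OF assms(10)]
  have G: "((\<lambda>p. prob {\<omega> \<in> space M. c \<le> \<bar>?G p \<omega> t - ?\<Phi> t\<bar>}) \<longlongrightarrow> 0) ?F" if "0 < c" for c t
    using boot_cdf_tendsto[OF assms(3,4,5,7) varW that, of t] by (simp add: case_prod_unfold)
  have C_meas [measurable]: "random_variable borel (?C p)" for p
    by (rule C_boot_measurable[OF assms(8,9)])
  have "tendsto_in_prob M (\<lambda>p \<omega>. ereal (?C p \<omega>)) z ?F"
  proof (rule tendsto_in_probI)
    show "prob_space M" by fact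
    show "- \<infinity> < z" using assms(8,10) by (cases z) auto
    show "random_variable borel (?C p)" for p by (rule C_meas)
  next
    fix l assume "ereal l < z"
    then obtain t where t: "l < t" "ereal t < z" using ereal_dense2 by (metis less_ereal.simps(1))
    define c where "c = \<alpha> - ?\<Phi> t"
    have c: "0 < c" using quantile(1)[OF t(2)] by (simp add: c_def)
    have "\<forall>\<^sub>F p in ?F. norm (prob {\<omega> \<in> space M. ?C p \<omega> \<le> l}) \<le> prob {\<omega> \<in> space M. c \<le> \<bar>?G p \<omega> t - ?\<Phi> t\<bar>}"
      using B
    proof eventually_elim
      case (elim p)
      have "{\<omega> \<in> space M. ?C p \<omega> \<le> l} \<subseteq> {\<omega> \<in> space M. c \<le> \<bar>?G p \<omega> t - ?\<Phi> t\<bar>}"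
      proof safe
        fix \<omega> assume "?C p \<omega> \<le> l"
        then have "\<alpha> \<le> ?G p \<omega> t"
          using t(1) by (intro C_boot_less_imp elim assms) simp
        then show "c \<le> \<bar>?G p \<omega> t - ?\<Phi> t\<bar>" unfolding c_def by linarith
      qed
      then show ?case by (simp add: finite_measure_mono)
    qed
    then show "((\<lambda>p. prob {\<omega> \<in> space M. ?C p \<omega> \<le> l}) \<longlongrightarrow> 0) ?F"
      by (rule Lim_null_comparison[OF _ G[OF c]])
  next
    fix u assume "z < ereal u"
    then obtain t where t: "z < ereal t" "t < u" using ereal_dense2 by (metis less_ereal.simps(1))
    define c where "c = ?\<Phi> t - \<alpha>"
    have c: "0 < c" using quantile(2)[OF t(1)] by (simp add: c_def)
    have "\<forall>\<^sub>F p in ?F. norm (prob {\<omega> \<in> space M. u \<le> ?C p \<omega>}) \<le> prob {\<omega> \<in> space M. c \<le> \<bar>?G p \<omega> t - ?\<Phi> t\<bar>}"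
      using B
    proof eventually_elim
      case (elim p)
      have "{\<omega> \<in> space M. u \<le> ?C p \<omega>} \<subseteq> {\<omega> \<in> space M. c \<le> \<bar>?G p \<omega> t - ?\<Phi> t\<bar>}"
      proof safe
        fix \<omega> assume "u \<le> ?C p \<omega>"
        then have "\<not> \<alpha> \<le> ?G p \<omega> t"
          using t(2) C_boot_le[OF elim assms(8,9), of "fst p" "\<lambda>i. X i \<omega>" "\<lambda>b i. \<zeta> b i \<omega>" t] by linarith
        then show "c \<le> \<bar>?G p \<omega> t - ?\<Phi> t\<bar>" unfolding c_def by linarith
      qed
      then show ?case by (simp add: finite_measure_mono)
    qed
    then show "((\<lambda>p. prob {\<omega> \<in> space M. u \<le> ?C p \<omega>}) \<longlongrightarrow> 0) ?F"
      by (rule Lim_null_comparison[OF _ G[OF c]])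
  qed
  then show ?thesis by (simp add: case_prod_unfold)
qed

end
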